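(* The semigroup free product of two word-hyperbolic monoids is word-hyperbolic (as a semigroup).
   Context: For a word $w=a_1\cdots a_n$ write $w^{\mathrm{rev}}=a_n\cdots a_1$. Let $S$ be a semigroup generated by a finite set $A$, with surjective homomorphism $\pi_S\colon A^+\to S$; $u=_Sv$ means $\pi_S(u)=\pi_S(v)$. A regular combing of $S$ is a regular language $R\subseteq A^+$ with $\pi_S(R)=S$. With $\#_1,\#_2$ new symbols not in $A$, let $\mathcal{T}_S(R)=\{u\#_1v\#_2w^{\mathrm{rev}}\mid u,v,w\in R,\ u\cdot v=_Sw\}$. $S$ is a word-hyperbolic semigroup if $\mathcal{T}_S(R)$ is context-free for some finite generating set $A$ and some regular combing $R$. A monoid is word-hyperbolic if it satisfies the same definition with $A^\ast$ in place of $A^+$; it is a known result of Duncan and Gilman that a monoid is word-hyperbolic in this sense if and only if it is word-hyperbolic as a semigroup. The semigroup free product of $S_1=\mathrm{Sgp}\langle A_1\mid\mathscr{R}_1\rangle$ and $S_2=\mathrm{Sgp}\langle A_2\mid\mathscr{R}_2\rangle$ with $A_1\cap A_2=\varnothing$ is $\mathrm{Sgp}\langle A_1\cup A_2\mid\mathscr{R}_1\cup\mathscr{R}_2\rangle$, i.e. the coproduct in the category of semigroups (identities of monoid factors are not identified). *)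

theory Defs
  imports "HOL-Algebra.Group"
begin

section \<open>Formal languages\<close>

text \<open>Only finitely many states, respectively nonterminals, ever occur, so it is no restriction
  to name them by natural numbers.\<close>

definition regular_language :: "'x set \<Rightarrow> 'x list set \<Rightarrow> bool" where
  "regular_language A L \<longleftrightarrow>
     (\<exists>(Q :: nat set) q0 (\<delta> :: nat \<Rightarrow> 'x \<Rightarrow> nat) F.
        finite Q \<and> q0 \<in> Q \<and> F \<subseteq> Q \<and> (\<forall>q\<in>Q. \<forall>a\<in>A. \<delta> q a \<in> Q) \<and>
        L = {w \<in> lists A. foldl \<delta> q0 w \<in> F})"

datatype ('n, 't) sym = Nt 'n | Tm 't

type_synonym ('n, 't) productions = "('n \<times> ('n, 't) sym list) set"

definition derive_step ::
  "('n, 't) productions \<Rightarrow> (('n, 't) sym list \<times> ('n, 't) sym list) set" where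
  "derive_step P = {(u @ [Nt N] @ v, u @ rhs @ v) | u v N rhs. (N, rhs) \<in> P}"

definition grammar_language :: "('n, 't) productions \<Rightarrow> 'n \<Rightarrow> 't list set" where
  "grammar_language P S = {w. ([Nt S], map Tm w) \<in> (derive_step P)\<^sup>*}"

definition context_free :: "'t list set \<Rightarrow> bool" where
  "context_free L \<longleftrightarrow>
     (\<exists>(P :: (nat, 't) productions) S. finite P \<and> L = grammar_language P S)"


section \<open>Semigroups, words and presentations\<close>

text \<open>A semigroup is represented by a HOL-Algebra \<open>monoid\<close> record whose unit slot is ignored:
  only \<open>carrier\<close> and \<open>mult\<close> are meaningful. The library's \<open>hom\<close>, \<open>epi\<close> and \<open>\<cong>\<close>
  refer to these two fields only, so for such records they are the semigroup notions.\<close>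

locale alg_semigroup =
  fixes G (structure)
  assumes m_closed: "\<lbrakk>x \<in> carrier G; y \<in> carrier G\<rbrakk> \<Longrightarrow> x \<otimes> y \<in> carrier G"
    and m_assoc: "\<lbrakk>x \<in> carrier G; y \<in> carrier G; z \<in> carrier G\<rbrakk>
                    \<Longrightarrow> (x \<otimes> y) \<otimes> z = x \<otimes> (y \<otimes> z)"

definition plus_words :: "'x set \<Rightarrow> 'x list set" where
  "plus_words A = {w \<in> lists A. w \<noteq> []}"

definition free_semigroup :: "'x set \<Rightarrow> 'x list monoid" where
  "free_semigroup A = \<lparr>carrier = plus_words A, monoid.mult = (@), one = undefined\<rparr>"

definition free_monoid :: "'x set \<Rightarrow> 'x list monoid" where
  "free_monoid A = \<lparr>carrier = lists A, monoid.mult = (@), one = []\<rparr>"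

definition presentation :: "'x set \<Rightarrow> ('x list \<times> 'x list) set \<Rightarrow> bool" where
  "presentation A \<R> \<longleftrightarrow> \<R> \<subseteq> plus_words A \<times> plus_words A"

inductive_set generated_congruence ::
  "'x set \<Rightarrow> ('x list \<times> 'x list) set \<Rightarrow> ('x list \<times> 'x list) set"
  for A :: "'x set" and \<R> :: "('x list \<times> 'x list) set" where
  base: "(u, v) \<in> \<R> \<Longrightarrow> (u, v) \<in> generated_congruence A \<R>"
| refl: "w \<in> plus_words A \<Longrightarrow> (w, w) \<in> generated_congruence A \<R>"
| sym: "(u, v) \<in> generated_congruence A \<R> \<Longrightarrow> (v, u) \<in> generated_congruence A \<R>"
| trans: "\<lbrakk>(u, v) \<in> generated_congruence A \<R>; (v, w) \<in> generated_congruence A \<R>\<rbrakk>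
            \<Longrightarrow> (u, w) \<in> generated_congruence A \<R>"
| mult: "\<lbrakk>(u, v) \<in> generated_congruence A \<R>; (u', v') \<in> generated_congruence A \<R>\<rbrakk>
            \<Longrightarrow> (u @ u', v @ v') \<in> generated_congruence A \<R>"

text \<open>The product below is the congruence class of the concatenations of representatives; see
  \<open>Sgp_mult_class\<close> for its independence of the representatives.\<close>

definition Sgp :: "'x set \<Rightarrow> ('x list \<times> 'x list) set \<Rightarrow> 'x list set monoid" where
  "Sgp A \<R> =
     \<lparr>carrier = plus_words A // generated_congruence A \<R>,
      monoid.mult = (\<lambda>X Y. generated_congruence A \<R> `` {u @ v | u v. u \<in> X \<and> v \<in> Y}),
      one = undefined\<rparr>"

definition semigroup_free_product ::
  "'x set \<Rightarrow> ('x list \<times> 'x list) set \<Rightarrow> 'x set \<Rightarrow> ('x list \<times> 'x list) set \<Rightarrow> 'x list set monoid"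
  where "semigroup_free_product A\<^sub>1 \<R>\<^sub>1 A\<^sub>2 \<R>\<^sub>2 = Sgp (A\<^sub>1 \<union> A\<^sub>2) (\<R>\<^sub>1 \<union> \<R>\<^sub>2)"

lemma append_plus_words:
  "u \<in> plus_words A \<Longrightarrow> v \<in> plus_words A \<Longrightarrow> u @ v \<in> plus_words A"
  by (auto simp: plus_words_def)

lemma generated_congruence_words:
  assumes "presentation A \<R>" "(u, v) \<in> generated_congruence A \<R>"
  shows "u \<in> plus_words A \<and> v \<in> plus_words A"
  using assms(2)
  by induction (use assms(1) in \<open>auto simp: presentation_def intro: append_plus_words\<close>)

lemma equiv_generated_congruence:
  assumes "presentation A \<R>"
  shows "equiv (plus_words A) (generated_congruence A \<R>)"
proof (rule equivI)
  show "generated_congruence A \<R> \<subseteq> plus_words A \<times> plus_words A"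
    using generated_congruence_words[OF assms] by auto
  show "refl_on (plus_words A) (generated_congruence A \<R>)"
    by (auto simp: refl_on_def intro: generated_congruence.refl)
  show "Relation.sym (generated_congruence A \<R>)"
    by (auto simp: sym_def intro: generated_congruence.sym)
  show "Relation.trans (generated_congruence A \<R>)"
    by (auto simp: trans_def intro: generated_congruence.trans)
qed

lemma Sgp_mult_class:
  assumes "presentation A \<R>" "u \<in> plus_words A" "v \<in> plus_words A"
  shows "(generated_congruence A \<R> `` {u}) \<otimes>\<^bsub>Sgp A \<R>\<^esub> (generated_congruence A \<R> `` {v})
           = generated_congruence A \<R> `` {u @ v}"
  using assms(2,3)
  by (auto simp: Sgp_def
      intro: generated_congruence.mult generated_congruence.trans generated_congruence.refl)

lemma alg_semigroup_Sgp:
  assumes "presentation A \<R>"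
  shows "alg_semigroup (Sgp A \<R>)"
proof -
  have carr: "X \<in> carrier (Sgp A \<R>) \<longleftrightarrow>
      (\<exists>w\<in>plus_words A. X = generated_congruence A \<R> `` {w})" for X
    by (auto simp: Sgp_def quotient_def)
  show ?thesis
    by unfold_locales
      (auto simp: carr Sgp_mult_class[OF assms] append_plus_words)
qed


section \<open>Word-hyperbolicity\<close>

datatype 'x marked = Letter 'x | Hash1 | Hash2

text \<open>The language \<open>{u #\<^sub>1 v #\<^sub>2 w\<^sup>r\<^sup>e\<^sup>v | u, v, w \<in> R, \<pi> (u v) = \<pi> w}\<close>.\<close>

definition multiplication_table :: "('x list \<Rightarrow> 's) \<Rightarrow> 'x list set \<Rightarrow> 'x marked list set" where
  "multiplication_table \<pi> R =
     {map Letter u @ [Hash1] @ map Letter v @ [Hash2] @ map Letter (rev w) | u v w.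
        u \<in> R \<and> v \<in> R \<and> w \<in> R \<and> \<pi> (u @ v) = \<pi> w}"

text \<open>A finite generating set is an abstract finite alphabet \<open>A\<close> together with a surjective
  homomorphism \<open>\<pi>\<close> from the words over \<open>A\<close>; \<open>\<pi>\<close> need not be injective on letters. As \<open>A\<close> is
  finite, its letters may be taken to be natural numbers. For monoids, empty words are allowed in
  the combing, hence also as components of the multiplication table.\<close>

definition word_hyperbolic_semigroup :: "('s, 'm) monoid_scheme \<Rightarrow> bool" where
  "word_hyperbolic_semigroup G \<longleftrightarrow> alg_semigroup G \<and>
     (\<exists>(A :: nat set) \<pi> R.
        finite A \<and> \<pi> \<in> epi (free_semigroup A) G \<and>
        R \<subseteq> plus_words A \<and> regular_language A R \<and> \<pi> ` R = carrier G \<and>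
        context_free (multiplication_table \<pi> R))"

definition word_hyperbolic_monoid :: "('s, 'm) monoid_scheme \<Rightarrow> bool" where
  "word_hyperbolic_monoid M \<longleftrightarrow> monoid M \<and>
     (\<exists>(A :: nat set) \<pi> R.
        finite A \<and> \<pi> \<in> epi (free_monoid A) M \<and> \<pi> [] = \<one>\<^bsub>M\<^esub> \<and>
        R \<subseteq> lists A \<and> regular_language A R \<and> \<pi> ` R = carrier M \<and>
        context_free (multiplication_table \<pi> R))"

end

theory Submission
  imports Defs "HOL-Library.Countable" "HOL-Library.Sublist"
begin

text \<open>Represent an element of a factor by a word of the combing of that factor, followed by a marker
  for the identity: these blocks are never empty, and the alternating sequences of blocks form a
  regular combing of the free product. The identities of the factors are not identified, so two
  normal forms are multiplied by concatenation, with at most one pair of adjacent blocks multiplied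
  in a factor. Hence a word of the multiplication table consists of nested pairs of blocks with
  equal values, around a product of two blocks or a change of side, around nested pairs again.
  The pairs of words with equal values in a factor form a context-free language because the factor
  is a monoid: fix a word \<open>e\<close> of its combing with value \<open>1\<close> and delete \<open>e\<close> from the table words
  \<open>u #\<^sub>1 e #\<^sub>2 w\<^sup>r\<^sup>e\<^sup>v\<close>, which is a rational transduction. The table of the free product is then
  generated by a grammar each of whose nonterminals has a context-free set of right-hand sides.\<close>

section \<open>Context-free grammars\<close>

text \<open>The combings of the factors need not represent elements uniquely. A block that the
  product leaves untouched may therefore reappear in \<open>w\<close> as a different word, so
  equality in a factor has to be context-free, not only its multiplication. The combings may also
  contain the empty word, which a semigroup combing excludes and which, as a block, would hide a
  change of side; the markers remove both difficulties. In a table word of a factor the separator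
  \<open>Hash2\<close> stands exactly where a block and its mirrored counterpart from
  \<open>w\<close> meet. Replacing it by a nonterminal nests the next pair of blocks inside, so each
  set of right-hand sides is a transduction of a factor's table. These sets are infinite in general,
  hence the passage from grammars with context-free sets of right-hand sides to finite ones. That
  congruent words have the same normal form is obtained from an action on sequences of factor
  elements, which replaces a confluence argument.\<close>

inductive yields :: "('n, 't) productions \<Rightarrow> ('n, 't) sym list \<Rightarrow> 't list \<Rightarrow> bool"
  for P where
  yields_Nil: "yields P [] []"
| yields_Tm: "yields P s w \<Longrightarrow> yields P (Tm a # s) (a # w)"
| yields_Nt: "\<lbrakk>(N, r) \<in> P; yields P r v; yields P s w\<rbrakk> \<Longrightarrow> yields P (Nt N # s) (v @ w)"

inductive_simps yields_simps [simp]: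
  "yields P [] w" "yields P (Tm a # s) w"

inductive_simps yields_Nt_iff: "yields P (Nt N # s) w"

lemma yields_append_iff:
  "yields P (s @ t) w \<longleftrightarrow> (\<exists>u v. w = u @ v \<and> yields P s u \<and> yields P t v)"
proof (induction s arbitrary: w)
  case Nil
  then show ?case by simp
next
  case (Cons X s)
  show ?case
  proof (cases X)
    case (Nt N)
    show ?thesis
      unfolding Nt append_Cons yields_Nt_iff Cons.IH by (metis append.assoc)
  next
    case (Tm a)
    show ?thesis
      unfolding Tm append_Cons yields_simps Cons.IH by (metis append_Cons)
  qed
qed

lemma yields_map_Tm [simp]: "yields P (map Tm u) w \<longleftrightarrow> w = u"
  by (induction u arbitrary: w) auto

lemma yields_singleton_iff: "yields P [Nt N] w \<longleftrightarrow> (\<exists>r. (N, r) \<in> P \<and> yields P r w)"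
  by (auto simp: yields_Nt_iff)

lemma derive_step_context:
  "(s, t) \<in> (derive_step P)\<^sup>* \<Longrightarrow> (x @ s @ y, x @ t @ y) \<in> (derive_step P)\<^sup>*"
proof (induction rule: rtrancl_induct)
  case (step t t')
  from step.hyps(2) obtain u N v r where "t = u @ [Nt N] @ v" "t' = u @ r @ v" "(N, r) \<in> P"
    by (auto simp: derive_step_def)
  then have "(x @ t @ y, x @ t' @ y) \<in> derive_step P"
    unfolding derive_step_def
    by (intro CollectI exI[of _ "x @ u"] exI[of _ "v @ y"] exI[of _ N] exI[of _ r]) auto
  with step.IH show ?case by (rule rtrancl_into_rtrancl)
qed auto

lemma yields_imp_derives: "yields P s w \<Longrightarrow> (s, map Tm w) \<in> (derive_step P)\<^sup>*"
proof (induction rule: yields.induct)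
  case (yields_Tm s w a)
  from derive_step_context[OF this(2), of "[Tm a]" "[]"] show ?case by simp
next
  case (yields_Nt N r v s w)
  have "(Nt N # s, r @ s) \<in> derive_step P"
    using yields_Nt(1) unfolding derive_step_def
    by (intro CollectI exI[of _ "[]"] exI[of _ s] exI[of _ N] exI[of _ r]) auto
  also have "(r @ s, map Tm v @ s) \<in> (derive_step P)\<^sup>*"
    using derive_step_context[OF yields_Nt.IH(1), of "[]" s] by simp
  also have "(map Tm v @ s, map Tm (v @ w)) \<in> (derive_step P)\<^sup>*"
    using derive_step_context[OF yields_Nt.IH(2), of "map Tm v" "[]"] by simp
  finally show ?case .
qed simp

text \<open>Induction backwards from the terminal word: to undo a step in a context
  \<open>u\<close>, \<open>v\<close>, the yield of \<open>u @ rhs @ v\<close> is split into three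
  parts.\<close>

lemma derives_imp_yields: "(s, map Tm w) \<in> (derive_step P)\<^sup>* \<Longrightarrow> yields P s w"
proof (induction rule: converse_rtrancl_induct)
  case (step s t)
  then show ?case
    by (auto simp: derive_step_def yields_append_iff yields_Nt_iff) blast
qed simp

text \<open>From here on \<open>yields\<close> replaces derivation sequences: it splits along
  concatenation, and induction on it follows the parse tree.\<close>

lemma grammar_language_eq_yields: "grammar_language P S = {w. yields P [Nt S] w}"
  unfolding grammar_language_def using yields_imp_derives derives_imp_yields by blast

lemma context_freeE:
  assumes "context_free L"
  obtains P :: "(nat, 't) productions" and S
  where "finite P" "L = {w. yields P [Nt S] w}"
  using assms unfolding context_free_def grammar_language_eq_yields by (elim exE conjE)

text \<open>This allows nonterminals of any countable type, although \<open>context_free\<close>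
  fixes natural numbers. Injectivity ensures that a production applicable after the renaming was
  applicable before it.\<close>

lemma yields_rename_iff:
  fixes f :: "'n \<Rightarrow> 'm"
  assumes "inj f"
  defines "g \<equiv> map (map_sym f id)"
  shows "yields ((\<lambda>(N, r). (f N, g r)) ` P) (g s) w \<longleftrightarrow> yields P s w"
proof
  let ?P = "(\<lambda>(N, r). (f N, g r)) ` P"
  show "yields P s w" if "yields ?P (g s) w"
    using that
  proof (induction "g s" w arbitrary: s rule: yields.induct)
    case yields_Nil
    then show ?case by (simp add: g_def)
  next
    case (yields_Tm s' w a)
    from yields_Tm(3) obtain X t where s: "s = X # t" "map_sym f id X = Tm a" "s' = g t"
      by (auto simp: g_def Cons_eq_map_conv)
    then have "X = Tm a" by (cases X) auto
    with s yields_Tm(2) show ?case by simp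
  next
    case (yields_Nt N r v s' w)
    from yields_Nt(6) obtain X t where s: "s = X # t" "map_sym f id X = Nt N" "s' = g t"
      by (auto simp: g_def Cons_eq_map_conv)
    then obtain M where X: "X = Nt M" "N = f M" by (cases X) auto
    with yields_Nt(1) \<open>inj f\<close> obtain r' where "(M, r') \<in> P" "r = g r'"
      by (auto dest: injD)
    with s X yields_Nt show ?case by (auto intro: yields.yields_Nt)
  qed
  show "yields ?P (g s) w" if "yields P s w"
    using that
  proof (induction rule: yields.induct)
    case (yields_Nt N r v s w)
    then have "(f N, g r) \<in> ?P" by force
    with yields_Nt show ?case by (auto simp: g_def intro: yields.yields_Nt)
  qed (auto simp: g_def)
qed

lemma context_free_yields:
  fixes P :: "('n::countable, 't) productions"
  assumes "finite P"
  shows "context_free {w. yields P [Nt S] w}"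
proof -
  let ?P = "(\<lambda>(N, r). (to_nat N, map (map_sym to_nat id) r)) ` P"
  have "{w. yields P [Nt S] w} = grammar_language ?P (to_nat S)"
    using yields_rename_iff[OF inj_to_nat, of P "[Nt S]"]
    by (simp add: grammar_language_eq_yields)
  then show ?thesis
    using assms unfolding context_free_def by blast
qed

lemma context_free_finite:
  assumes "finite L"
  shows "context_free L"
proof -
  have "L = {w. yields ((\<lambda>w. ((), map Tm w)) ` L) [Nt ()] w}"
    by (auto simp: yields_singleton_iff)
  then show ?thesis
    using context_free_yields assms by (metis finite_imageI)
qed

section \<open>Images of context-free languages under finite transducers\<close>

inductive run :: "('q \<times> 'a \<times> 'b list \<times> 'q) set \<Rightarrow> 'q \<Rightarrow> 'a list \<Rightarrow> 'b list \<Rightarrow> 'q \<Rightarrow> bool"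
  for \<delta> where
  run_Nil: "run \<delta> q [] [] q"
| run_Cons: "\<lbrakk>(p, a, y, p') \<in> \<delta>; run \<delta> p' w v q\<rbrakk> \<Longrightarrow> run \<delta> p (a # w) (y @ v) q"

inductive_simps run_simps: "run \<delta> p [] v q" "run \<delta> p (a # w) v q"

lemma run_append_iff:
  "run \<delta> p (w @ w') x q \<longleftrightarrow> (\<exists>v v' p'. x = v @ v' \<and> run \<delta> p w v p' \<and> run \<delta> p' w' v' q)"
proof (induction w arbitrary: p x)
  case (Cons a w)
  show ?case
    unfolding append_Cons run_simps Cons.IH by (metis append.assoc)
qed (simp add: run_simps)

lemma run_closed: "run \<delta> p w v q \<Longrightarrow> \<delta> \<subseteq> Q \<times> UNIV \<times> UNIV \<times> Q \<Longrightarrow> p \<in> Q \<Longrightarrow> q \<in> Q"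
  by (induction rule: run.induct) auto

text \<open>The state guesses of the Bar-Hillel triple construction: each symbol of a right-hand
  side is decorated with the states in which its part of the input is entered and left.\<close>

inductive threads ::
  "'q set \<Rightarrow> 'q \<Rightarrow> ('n, 'a) sym list \<Rightarrow> ('q \<times> ('n, 'a) sym \<times> 'q, 'b) sym list \<Rightarrow> 'q \<Rightarrow> bool"
  for Q where
  threads_Nil: "threads Q q [] [] q"
| threads_Cons: "\<lbrakk>p' \<in> Q; threads Q p' r s q\<rbrakk> \<Longrightarrow> threads Q p (X # r) (Nt (p, X, p') # s) q"

inductive_simps threads_simps: "threads Q p [] s q" "threads Q p (X # r) s q"

lemma finite_threads: "finite Q \<Longrightarrow> finite {(s, q). threads Q p r s q}"
proof (induction r arbitrary: p)
  case Nil
  have "{(s, q). threads Q p [] s q} = {([], p)}" by (auto simp: threads_simps)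
  then show ?case by (metis finite.emptyI finite.insertI)
next
  case (Cons X r)
  have eq: "{(s, q). threads Q p (X # r) s q} =
      (\<Union>p'\<in>Q. (\<lambda>(s, q). (Nt (p, X, p') # s, q)) ` {(s, q). threads Q p' r s q})"
    by (auto simp: threads_simps)
  show ?case
    unfolding eq using Cons by (intro finite_UN_I finite_imageI)
qed

text \<open>\<open>(p, X, q)\<close> derives the outputs of the runs from \<open>p\<close> to \<open>q\<close> on words derived from \<open>X\<close>.\<close>

definition transducer_productions ::
  "'q set \<Rightarrow> ('q \<times> 'a \<times> 'b list \<times> 'q) set \<Rightarrow> ('n, 'a) productions \<Rightarrow>
     ('q \<times> ('n, 'a) sym \<times> 'q, 'b) productions" where
  "transducer_productions Q \<delta> P =
     {((p, Tm a, q), map Tm y) | p a y q. (p, a, y, q) \<in> \<delta>} \<union>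
     {((p, Nt N, q), s) | p N q s. p \<in> Q \<and> (\<exists>r. (N, r) \<in> P \<and> threads Q p r s q)}"

lemma finite_transducer_productions:
  fixes \<delta> :: "('q \<times> 'a \<times> 'b list \<times> 'q) set" and P :: "('n, 'a) productions"
  assumes "finite Q" "finite \<delta>" "finite P"
  shows "finite (transducer_productions Q \<delta> P)"
proof -
  have "transducer_productions Q \<delta> P =
      (\<lambda>(p, a, y, q). ((p, Tm a, q), map Tm y)) ` \<delta> \<union>
      (\<Union>p\<in>Q. \<Union>(N, r)\<in>P. (\<lambda>(s, q). ((p, Nt N, q), s)) ` {(s, q). threads Q p r s q})"
    unfolding transducer_productions_def by (intro arg_cong2[of _ _ _ _ "(\<union>)"]) force+
  moreover have "finite (\<Union>p\<in>Q. \<Union>(N, r)\<in>P.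
      (\<lambda>(s, q). ((p, Nt N :: ('n, 'a) sym, q), s)) ` {(s, q). threads Q p r s q})"
    using assms finite_threads[OF assms(1)] by (intro finite_UN_I) auto
  ultimately show ?thesis
    using assms(2) by simp
qed

text \<open>Stated for whole threads instead of a single triple, because the induction descends into
  right-hand sides. The terminal case is void: a thread consists of triples only.\<close>

lemma yields_transducer_productionsD:
  assumes "yields (transducer_productions Q \<delta> P) s v" "threads Q p r s q" "p \<in> Q"
  shows "\<exists>w. yields P r w \<and> run \<delta> p w v q"
  using assms
proof (induction arbitrary: p r q rule: yields.induct)
  case yields_Nil
  from yields_Nil.prems(1) have "r = [] \<and> q = p" by cases auto
  then show ?case by (auto intro: run.intros)
next
  case (yields_Tm s w a)
  then show ?case by (auto elim: threads.cases)
next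
  case (yields_Nt M s' v s w)
  from yields_Nt.prems(1) obtain p' X r'
    where M: "M = (p, X, p')" and r: "r = X # r'" "p' \<in> Q" "threads Q p' r' s q"
    by (auto elim: threads.cases)
  from yields_Nt.IH(2)[OF r(3,2)] obtain u where u: "yields P r' u" "run \<delta> p' u w q" by blast
  show ?case
  proof (cases X)
    case (Tm a)
    with yields_Nt.hyps(1) M have "\<exists>y. s' = map Tm y \<and> (p, a, y, p') \<in> \<delta>"
      by (auto simp: transducer_productions_def)
    with yields_Nt.hyps(2) have "(p, a, v, p') \<in> \<delta>" by auto
    then have "run \<delta> p (a # u) (v @ w) q" using u by (auto intro: run.intros)
    with u r Tm show ?thesis by (auto simp del: run_simps)
  next
    case (Nt N)
    with yields_Nt.hyps(1) M obtain r'' where r'': "(N, r'') \<in> P" "threads Q p r'' s' p'"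
      by (auto simp: transducer_productions_def)
    from yields_Nt.IH(1)[OF r''(2) yields_Nt.prems(2)]
    obtain u' where "yields P r'' u'" "run \<delta> p u' v p'" by blast
    with u have "run \<delta> p (u' @ u) (v @ w) q" by (auto simp: run_append_iff)
    moreover have "yields P (Nt N # r') (u' @ u)"
      using r'' u \<open>yields P r'' u'\<close> by (auto intro: yields.yields_Nt)
    ultimately show ?thesis using r Nt by blast
  qed
qed

text \<open>The states that the run visits between the parts of the input are the correct guesses;
  they stay in \<open>Q\<close> because all transitions of \<open>\<delta>\<close> do.\<close>

lemma yields_transducer_productionsI:
  assumes "yields P r w" "run \<delta> p w v q" "p \<in> Q" "\<delta> \<subseteq> Q \<times> UNIV \<times> UNIV \<times> Q"
  shows "\<exists>s. threads Q p r s q \<and> yields (transducer_productions Q \<delta> P) s v"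
  using assms(1-3)
proof (induction arbitrary: p v q rule: yields.induct)
  case yields_Nil
  then show ?case by (auto simp: run_simps intro: threads.intros)
next
  case (yields_Tm r w a)
  from yields_Tm.prems obtain y p' v'
    where *: "(p, a, y, p') \<in> \<delta>" "v = y @ v'" "run \<delta> p' w v' q"
    by (auto simp: run_simps)
  with assms(4) have "p' \<in> Q" by auto
  with yields_Tm.IH[OF *(3) \<open>p' \<in> Q\<close>] obtain s
    where "threads Q p' r s q" "yields (transducer_productions Q \<delta> P) s v'" by blast
  moreover have "((p, Tm a, p'), map Tm y) \<in> transducer_productions Q \<delta> P"
    using * by (auto simp: transducer_productions_def)
  ultimately show ?case
    using * \<open>p' \<in> Q\<close>
    by (auto intro!: exI[of _ "Nt (p, Tm a, p') # s"] threads.intros yields.yields_Nt)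
next
  case (yields_Nt N r u t w)
  from yields_Nt.prems(1) obtain v1 v2 p'
    where *: "v = v1 @ v2" "run \<delta> p u v1 p'" "run \<delta> p' w v2 q" by (auto simp: run_append_iff)
  have "p' \<in> Q" using run_closed[OF *(2) assms(4) yields_Nt.prems(2)] .
  with yields_Nt.IH(2)[OF *(3)] obtain s
    where s: "threads Q p' t s q" "yields (transducer_productions Q \<delta> P) s v2" by blast
  from yields_Nt.IH(1)[OF *(2) yields_Nt.prems(2)] obtain s'
    where s': "threads Q p r s' p'" "yields (transducer_productions Q \<delta> P) s' v1" by blast
  have "((p, Nt N, p'), s') \<in> transducer_productions Q \<delta> P"
    using s' yields_Nt by (auto simp: transducer_productions_def)
  then show ?case
    using * s s' \<open>p' \<in> Q\<close>
    by (auto intro!: exI[of _ "Nt (p, Nt N, p') # s"] threads.intros yields.yields_Nt)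
qed

instance sym :: (countable, countable) countable
  by countable_datatype

text \<open>States and input letters become parts of nonterminals in the triple grammar, hence the
  countability of both types.\<close>

theorem context_free_transducer:
  fixes \<delta> :: "('q::countable \<times> 'a::countable \<times> 'b list \<times> 'q) set"
  assumes "context_free L" "finite Q" "finite \<delta>" "\<delta> \<subseteq> Q \<times> UNIV \<times> UNIV \<times> Q" "q0 \<in> Q" "q1 \<in> Q"
  shows "context_free {v. \<exists>w\<in>L. run \<delta> q0 w v q1}"
proof -
  obtain P :: "(nat, 'a) productions" and S where P: "finite P" "L = {w. yields P [Nt S] w}"
    using context_freeE[OF assms(1)] .
  let ?P = "transducer_productions Q \<delta> P"
  have "{v. \<exists>w\<in>L. run \<delta> q0 w v q1} = {v. yields ?P [Nt (q0, Nt S, q1)] v}"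
  proof (intro equalityI subsetI; clarsimp)
    fix v w assume "w \<in> L" "run \<delta> q0 w v q1"
    then show "yields ?P [Nt (q0, Nt S, q1)] v"
      using yields_transducer_productionsI[of P "[Nt S]" w \<delta> q0 v q1 Q] P assms
      by (auto simp: threads_simps)
  next
    fix v assume "yields ?P [Nt (q0, Nt S, q1)] v"
    from yields_transducer_productionsD[OF this] assms P
    show "\<exists>w\<in>L. run \<delta> q0 w v q1" by (auto simp: threads_simps)
  qed
  then show ?thesis
    using context_free_yields[OF finite_transducer_productions[OF assms(2,3) P(1)]] by simp
qed

section \<open>Grammars with context-free sets of right-hand sides\<close>

text \<open>A recursive form of closure under substitution. Each \<open>L k\<close> has a finite
  grammar whose terminals are themselves symbols; the union of these grammars, with a terminal
  \<open>Nt j\<close> turned into a call of the start symbol of component \<open>j\<close>, is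
  finite because \<open>'k\<close> is.\<close>

theorem context_free_extended_grammar:
  fixes L :: "'k::finite \<Rightarrow> ('k, 't) sym list set"
  assumes "\<And>k. context_free (L k)"
  shows "context_free {w. yields {(k, r). r \<in> L k} [Nt k0] w}"
proof -
  define E where "E = {(k, r). r \<in> L k}"
  have "\<exists>P S. finite (P :: (nat, ('k, 't) sym) productions) \<and> L k = {w. yields P [Nt S] w}"
    for k
    by (rule context_freeE[OF assms[of k]]) blast
  then obtain P :: "'k \<Rightarrow> (nat, ('k, 't) sym) productions" and S
    where fin: "finite (P k)" and L: "L k = {w. yields (P k) [Nt (S k)] w}" for k
    by metis
  \<comment> \<open>\<open>g\<close> turns the letters of a right-hand side into calls or true
    terminals; \<open>h k\<close> also tags the inner nonterminals of component \<open>k\<close>,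
    which keeps the components apart.\<close>
  define g :: "('k, 't) sym \<Rightarrow> ('k \<times> nat, 't) sym"
    where "g = case_sym (\<lambda>j. Nt (j, S j)) Tm"
  define h :: "'k \<Rightarrow> (nat, ('k, 't) sym) sym \<Rightarrow> ('k \<times> nat, 't) sym"
    where "h k = case_sym (\<lambda>N. Nt (k, N)) g" for k
  define G where "G = (\<Union>k. (\<lambda>(N, r). ((k, N), map (h k) r)) ` P k)"
  have G_iff: "((k, N), s) \<in> G \<longleftrightarrow> (\<exists>r. (N, r) \<in> P k \<and> s = map (h k) r)" for k N s
    unfolding G_def by force

  \<comment> \<open>Two layers are composed: a parse inside component \<open>k\<close> producing
    \<open>x\<close>, and the expansion in \<open>G\<close> of the letters of
    \<open>x\<close>.\<close>
  have lift: "yields G (map (h k) r) w"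
    if "yields (P k) r x" "yields G (map g x) w" for k r x w
    using that
  proof (induction arbitrary: w rule: yields.induct)
    case (yields_Tm s v a)
    have "map (h k) (Tm a # s) = [g a] @ map (h k) s" by (simp add: h_def)
    moreover from yields_Tm.prems(1) obtain w1 w2
      where "w = w1 @ w2" "yields G [g a] w1" "yields G (map g v) w2"
      using yields_append_iff[of G "[g a]" "map g v" w] by auto
    ultimately show ?case using yields_Tm by (auto simp only: yields_append_iff)
  next
    case (yields_Nt N r v s x)
    from yields_Nt.prems(1) obtain w1 w2
      where w: "w = w1 @ w2" "yields G (map g v) w1" "yields G (map g x) w2"
      by (auto simp: yields_append_iff)
    have "((k, N), map (h k) r) \<in> G" using yields_Nt by (auto simp: G_iff)
    with w yields_Nt show ?case by (auto simp: h_def intro!: yields.yields_Nt)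
  qed simp

  have E_imp_G: "yields G (map g s) w" if "yields E s w" for s w
    using that
  proof (induction rule: yields.induct)
    case (yields_Nt k r v s w)
    then have "r \<in> L k" by (auto simp: E_def)
    then have "yields G (map (h k) [Nt (S k)]) v"
      using yields_Nt.IH(1) L by (intro lift[of k "[Nt (S k)]" r v]) auto
    then show ?case
      using yields_Nt.IH(2) yields_append_iff[of G "[Nt (k, S k)]" "map g s" "v @ w"]
      by (auto simp: g_def h_def)
  qed (auto simp: g_def)

  \<comment> \<open>The converse separates the layers again: \<open>x\<close> is what component
    \<open>k\<close> alone produces before any call is expanded.\<close>
  have G_imp_E: "\<exists>x. yields (P k) r x \<and> yields E x w" if "yields G (map (h k) r) w" for k r w
    using that
  proof (induction "map (h k) r" w arbitrary: k r rule: yields.induct)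
    case yields_Nil
    then show ?case by auto
  next
    case (yields_Tm s w a)
    from yields_Tm.hyps(3) obtain X r' where r: "r = X # r'" "s = map (h k) r'" "h k X = Tm a"
      by (auto simp: Cons_eq_map_conv)
    then have "X = Tm (Tm a)" by (auto simp: h_def g_def split: sym.splits)
    with yields_Tm.hyps(2)[OF r(2)] r obtain x where "yields (P k) r' x" "yields E x w" by blast
    then have "yields (P k) r (Tm a # x)" "yields E (Tm a # x) (a # w)"
      using r \<open>X = _\<close> by simp_all
    then show ?case by blast
  next
    case (yields_Nt M t v s w)
    from yields_Nt.hyps(6) obtain X r' where r: "r = X # r'" "s = map (h k) r'" "h k X = Nt M"
      by (auto simp: Cons_eq_map_conv)
    from yields_Nt.hyps(5)[OF r(2)] obtain x where x: "yields (P k) r' x" "yields E x w" by blast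
    obtain j N where M: "M = (j, N)" by force
    with yields_Nt.hyps(1) obtain q where q: "(N, q) \<in> P j" "t = map (h j) q"
      by (auto simp: G_iff)
    from yields_Nt.hyps(3)[OF q(2)] obtain y where y: "yields (P j) q y" "yields E y v" by blast
    \<comment> \<open>\<open>h k\<close> is not injective: a call of component \<open>k\<close> from
      within itself and its inner start symbol have the same image. The case distinction is
      therefore on \<open>X\<close>.\<close>
    have "X = Nt N \<and> j = k \<or> X = Tm (Nt j) \<and> N = S j"
      using r(3) M by (auto simp: h_def g_def split: sym.splits)
    then show ?case
    proof (elim disjE conjE)
      assume "X = Nt N" "j = k"
      then have "yields (P k) r (y @ x)"
        using x y q r by (auto intro: yields.yields_Nt)
      moreover have "yields E (y @ x) (v @ w)"
        using x y by (auto simp: yields_append_iff)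
      ultimately show ?thesis by blast
    next
      assume X: "X = Tm (Nt j)" "N = S j"
      with y q have "y \<in> L j" by (auto simp: L yields_singleton_iff)
      with q have "(j, y) \<in> E" by (auto simp: E_def)
      then have "yields E (Nt j # x) (v @ w)"
        using x y by (auto intro: yields.yields_Nt)
      moreover have "yields (P k) r (Nt j # x)"
        using x r X by simp
      ultimately show ?thesis by blast
    qed
  qed

  have "yields E [Nt k0] w \<longleftrightarrow> yields G [Nt (k0, S k0)] w" for w
  proof
    assume "yields G [Nt (k0, S k0)] w"
    with G_imp_E[of k0 "[Nt (S k0)]" w] obtain x
      where "yields (P k0) [Nt (S k0)] x" "yields E x w" by (auto simp: h_def)
    with L show "yields E [Nt k0] w" by (auto simp: E_def yields_singleton_iff)
  qed (use E_imp_G[of "[Nt k0]"] in \<open>auto simp: g_def\<close>)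
  moreover have "finite G"
    unfolding G_def using fin by auto
  ultimately show ?thesis
    unfolding E_def[symmetric] using context_free_yields[of G] by simp
qed

section \<open>Alternating words\<close>

lemma regular_languageI:
  fixes \<delta> :: "'q::countable \<Rightarrow> 'x \<Rightarrow> 'q"
  assumes "finite Q" "q0 \<in> Q" "F \<subseteq> Q" "\<And>q a. q \<in> Q \<Longrightarrow> a \<in> A \<Longrightarrow> \<delta> q a \<in> Q"
  shows "regular_language A {w \<in> lists A. foldl \<delta> q0 w \<in> F}"
proof -
  define \<delta>' :: "nat \<Rightarrow> 'x \<Rightarrow> nat" where "\<delta>' n a = to_nat (\<delta> (from_nat n) a)" for n a
  have "foldl \<delta>' (to_nat q) w = to_nat (foldl \<delta> q w)" for q w
    by (induction w arbitrary: q) (auto simp: \<delta>'_def)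
  then have "{w \<in> lists A. foldl \<delta> q0 w \<in> F} =
      {w \<in> lists A. foldl \<delta>' (to_nat q0) w \<in> to_nat ` F}"
    by (simp add: inj_image_mem_iff)
  moreover have "\<forall>q\<in>to_nat ` Q. \<forall>a\<in>A. \<delta>' q a \<in> to_nat ` Q"
    using assms(4) by (auto simp: \<delta>'_def)
  ultimately show ?thesis
    unfolding regular_language_def using assms(1-3)
    by (intro exI[of _ "to_nat ` Q"] exI[of _ "to_nat q0"] exI[of _ \<delta>'] exI[of _ "to_nat ` F"])
      auto
qed

text \<open>A letter \<open>a\<close> of the alphabet of factor \<open>i\<close> is coded with parity \<open>i\<close>; the codes \<open>0\<close> and
  \<open>1\<close> are kept for the markers, which will represent the identities of the factors.\<close>

definition letter :: "bool \<Rightarrow> nat \<Rightarrow> nat" where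
  "letter i a = 2 * Suc a + of_bool i"

definition marker :: "bool \<Rightarrow> nat" where
  "marker i = of_bool i"

definition block :: "bool \<Rightarrow> nat list \<Rightarrow> nat list" where
  "block i u = map (letter i) u @ [marker i]"

fun alternating_word :: "bool \<Rightarrow> nat list list \<Rightarrow> nat list" where
  "alternating_word i [] = []"
| "alternating_word i (b # bs) = block i b @ alternating_word (\<not> i) bs"

fun alternating_in :: "(bool \<Rightarrow> nat list set) \<Rightarrow> bool \<Rightarrow> nat list list \<Rightarrow> bool" where
  "alternating_in R i [] \<longleftrightarrow> True"
| "alternating_in R i (b # bs) \<longleftrightarrow> b \<in> R i \<and> alternating_in R (\<not> i) bs"

definition alternating_language :: "(bool \<Rightarrow> nat list set) \<Rightarrow> nat list set" where
  "alternating_language R = {alternating_word i bs | i bs. bs \<noteq> [] \<and> alternating_in R i bs}"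

definition free_product_alphabet :: "(bool \<Rightarrow> nat set) \<Rightarrow> nat set" where
  "free_product_alphabet B = range marker \<union> (\<Union>i. letter i ` B i)"

lemma even_letter [simp]: "even (letter i a) \<longleftrightarrow> \<not> i" and even_marker [simp]: "even (marker i) \<longleftrightarrow> \<not> i"
  by (auto simp: letter_def marker_def)

lemma letter_div_2 [simp]: "letter i a div 2 = Suc a" and marker_div_2 [simp]: "marker i div 2 = 0"
  by (auto simp: letter_def marker_def)

lemma finite_free_product_alphabet: "(\<And>i. finite (B i)) \<Longrightarrow> finite (free_product_alphabet B)"
  by (simp add: free_product_alphabet_def)

lemma free_product_alphabet_cases:
  assumes "c \<in> free_product_alphabet B"
  obtains (marker) i where "c = marker i" | (letter) i a where "a \<in> B i" "c = letter i a"
  using assms by (auto simp: free_product_alphabet_def)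

lemma alternating_word_in_lists:
  assumes "\<And>i. R i \<subseteq> lists (B i)"
  shows "alternating_in R i bs \<Longrightarrow> alternating_word i bs \<in> lists (free_product_alphabet B)"
proof (induction bs arbitrary: i)
  case (Cons b bs)
  then have "b \<in> lists (B i)" using assms by (meson alternating_in.simps(2) subsetD)
  then have "map (letter i) b \<in> lists (free_product_alphabet B)"
    by (auto simp: free_product_alphabet_def in_lists_conv_set)
  with Cons show ?case by (auto simp: block_def free_product_alphabet_def)
qed simp

lemma alternating_word_eq_Nil_iff [simp]: "alternating_word i bs = [] \<longleftrightarrow> bs = []"
  by (cases bs) (auto simp: block_def)

lemma alternating_language_subset:
  assumes "\<And>i. R i \<subseteq> lists (B i)"
  shows "alternating_language R \<subseteq> plus_words (free_product_alphabet B)"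
  unfolding alternating_language_def plus_words_def
  using alternating_word_in_lists[of R B] assms by auto

section \<open>An automaton for alternating words\<close>

text \<open>The index of \<open>Inside\<close> is the side of the current block, that of
  \<open>Completed\<close> the side of the next one. Only \<open>Completed\<close> states accept,
  since a word has to end with a marker.\<close>

datatype alternation_state = Dead | Init | Inside bool nat | Completed bool

instance alternation_state :: countable
  by countable_datatype

fun block_state :: "(bool \<Rightarrow> nat) \<Rightarrow> alternation_state \<Rightarrow> bool \<Rightarrow> nat option" where
  "block_state q0 Dead i = None"
| "block_state q0 Init i = Some (q0 i)"
| "block_state q0 (Inside j q) i = (if i = j then Some q else None)"
| "block_state q0 (Completed j) i = (if i = j then Some (q0 i) else None)"

definition alternation_step ::
  "(bool \<Rightarrow> nat) \<Rightarrow> (bool \<Rightarrow> nat \<Rightarrow> nat \<Rightarrow> nat) \<Rightarrow> (bool \<Rightarrow> nat set) \<Rightarrow>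
     alternation_state \<Rightarrow> nat \<Rightarrow> alternation_state" where
  "alternation_step q0 \<delta> F s c =
     (case block_state q0 s (odd c) of
        None \<Rightarrow> Dead
      | Some q \<Rightarrow>
          if c div 2 = 0 then if q \<in> F (odd c) then Completed (even c) else Dead
          else Inside (odd c) (\<delta> (odd c) q (c div 2 - 1)))"

lemma alternation_step_marker:
  "alternation_step q0 \<delta> F s (marker i) =
     (case block_state q0 s i of None \<Rightarrow> Dead
      | Some q \<Rightarrow> if q \<in> F i then Completed (\<not> i) else Dead)"
  by (auto simp: alternation_step_def split: option.splits)

lemma alternation_step_letter:
  "alternation_step q0 \<delta> F s (letter i a) =
     (case block_state q0 s i of None \<Rightarrow> Dead | Some q \<Rightarrow> Inside i (\<delta> i q a))"
  by (auto simp: alternation_step_def split: option.splits)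

lemma regular_alternating_language:
  assumes "\<And>i. regular_language (B i) (R i)"
  shows "regular_language (free_product_alphabet B) (alternating_language R)"
proof -
  let ?dfa = "\<lambda>i (Q :: nat set) q0 \<delta> F. finite Q \<and> q0 \<in> Q \<and> F \<subseteq> Q \<and> (\<forall>q\<in>Q. \<forall>a\<in>B i. \<delta> q a \<in> Q) \<and>
      R i = {w \<in> lists (B i). foldl \<delta> q0 w \<in> F}"
  have "\<forall>i. \<exists>Q q0 \<delta> F. ?dfa i Q q0 \<delta> F"
    using assms unfolding regular_language_def by (rule allI)
  from choice[OF this] obtain Q where "\<forall>i. \<exists>q0 \<delta> F. ?dfa i (Q i) q0 \<delta> F" ..
  from choice[OF this] obtain q0 where "\<forall>i. \<exists>\<delta> F. ?dfa i (Q i) (q0 i) \<delta> F" ..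
  from choice[OF this] obtain \<delta> where "\<forall>i. \<exists>F. ?dfa i (Q i) (q0 i) (\<delta> i) F" ..
  from choice[OF this] obtain F where dfa: "\<forall>i. ?dfa i (Q i) (q0 i) (\<delta> i) (F i)" ..
  have finQ: "finite (Q i)" and q0: "q0 i \<in> Q i"
    and R: "R i = {w \<in> lists (B i). foldl (\<delta> i) (q0 i) w \<in> F i}"
    and closed: "q \<in> Q i \<Longrightarrow> a \<in> B i \<Longrightarrow> \<delta> i q a \<in> Q i" for i q a
    using spec[OF dfa, of i] by (elim conjE, (assumption | blast))+
  let ?A = "free_product_alphabet B"
  let ?\<delta> = "alternation_step q0 \<delta> F"
  define S where "S = {Dead, Init} \<union> (\<Union>i. Inside i ` Q i) \<union> range Completed"
  have S_iff: "Dead \<in> S" "Completed j \<in> S" "Inside i q \<in> S \<longleftrightarrow> q \<in> Q i" for i j q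
    by (auto simp: S_def)

  have block: "foldl ?\<delta> s (block i b) = (if foldl (\<delta> i) q b \<in> F i then Completed (\<not> i) else Dead)"
    if "block_state q0 s i = Some q" for s i q b
    using that
  proof (induction b arbitrary: s q)
    case (Cons a b)
    from Cons.IH[of "Inside i (\<delta> i q a)" "\<delta> i q a"] Cons.prems show ?case
      by (simp add: block_def alternation_step_letter)
  qed (simp add: block_def alternation_step_marker)

  have run: "foldl ?\<delta> s (alternating_word i bs) \<in> range Completed"
    if "bs \<noteq> []" "alternating_in R i bs" "block_state q0 s i = Some (q0 i)" for s i bs
    using that
  proof (induction bs arbitrary: s i)
    case (Cons b bs)
    then have "foldl ?\<delta> s (block i b) = Completed (\<not> i)"
      by (auto simp: block R)
    with Cons show ?case by (cases "bs = []") auto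
  qed simp

  have dead: "foldl ?\<delta> Dead w = Dead" for w
    by (induction w) (auto simp: alternation_step_def)
  \<comment> \<open>On a nonempty rest the states \<open>Completed i\<close> and \<open>Init\<close>
    can be exchanged for a suitable \<open>Inside\<close> state, so \<open>parse\<close> has to
    treat \<open>Inside\<close> only.\<close>
  have restart: "?\<delta> s c = ?\<delta> (Inside i q) c"
    if "s = Completed i \<and> q = q0 i \<or> s = Init \<and> q = q0 i \<and> odd c = i" for s i q c
    using that by (auto simp: alternation_step_def)

  \<comment> \<open>The reading may start in the middle of a block: \<open>b\<close> is the rest of
    that block, so it is accepted from \<open>q\<close> and not from the initial state.\<close>
  have parse: "\<exists>b bs. w = map (letter i) b @ marker i # alternating_word (\<not> i) bs \<and>
      b \<in> lists (B i) \<and> foldl (\<delta> i) q b \<in> F i \<and> alternating_in R (\<not> i) bs"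
    if "w \<in> lists ?A" "foldl ?\<delta> (Inside i q) w \<in> range Completed" for w i q
    using that
  proof (induction w arbitrary: i q rule: list.induct)
    case Nil
    then show ?case by auto
  next
    case (Cons c w)
    from Cons.prems(1) have "c \<in> ?A" "w \<in> lists ?A" by auto
    from \<open>c \<in> ?A\<close> show ?case
    proof (cases rule: free_product_alphabet_cases)
      case (marker j)
      with Cons.prems(2) dead have c: "j = i" "q \<in> F i" "foldl ?\<delta> (Completed (\<not> i)) w \<in> range Completed"
        by (auto simp: alternation_step_marker split: if_splits)
      show ?thesis
      proof (cases w)
        case Nil
        with marker c show ?thesis by (auto intro!: exI[of _ "[]"])
      next
        case (Cons c' w')
        with c(3) have "foldl ?\<delta> (Inside (\<not> i) (q0 (\<not> i))) w \<in> range Completed"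
          using restart[of "Completed (\<not> i)" "\<not> i" "q0 (\<not> i)" c'] by simp
        from Cons.IH[OF \<open>w \<in> lists ?A\<close> this] obtain b bs
          where "w = map (letter (\<not> i)) b @ marker (\<not> i) # alternating_word i bs"
            "b \<in> lists (B (\<not> i))" "foldl (\<delta> (\<not> i)) (q0 (\<not> i)) b \<in> F (\<not> i)" "alternating_in R i bs"
          by auto
        then have "w = alternating_word (\<not> i) (b # bs)" "alternating_in R (\<not> i) (b # bs)"
          by (simp_all add: block_def R)
        with marker c(1,2) show ?thesis
          by (intro exI[of _ "[]"] exI[of _ "b # bs"]) simp
      qed
    next
      case (letter j a)
      with Cons.prems(2) dead have c: "j = i" "foldl ?\<delta> (Inside i (\<delta> i q a)) w \<in> range Completed"
        by (auto simp: alternation_step_letter split: if_splits)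
      from Cons.IH[OF \<open>w \<in> lists ?A\<close> c(2)] obtain b bs
        where "w = map (letter i) b @ marker i # alternating_word (\<not> i) bs"
          "b \<in> lists (B i)" "foldl (\<delta> i) (\<delta> i q a) b \<in> F i" "alternating_in R (\<not> i) bs"
        by auto
      with letter c show ?thesis
        by (intro exI[of _ "a # b"] exI[of _ bs]) auto
    qed
  qed

  have "alternating_language R = {w \<in> lists ?A. foldl ?\<delta> Init w \<in> range Completed}"
  proof (intro equalityI subsetI)
    fix w assume "w \<in> alternating_language R"
    then obtain i bs where w: "w = alternating_word i bs" "bs \<noteq> []" "alternating_in R i bs"
      by (auto simp: alternating_language_def)
    have "R i \<subseteq> lists (B i)" for i using R by auto
    from alternating_word_in_lists[OF this w(3)] have "w \<in> lists ?A" using w(1) by simp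
    then show "w \<in> {w \<in> lists ?A. foldl ?\<delta> Init w \<in> range Completed}"
      using run[OF w(2,3), of Init] w(1) by simp
  next
    fix w assume w: "w \<in> {w \<in> lists ?A. foldl ?\<delta> Init w \<in> range Completed}"
    then obtain c w' where "w = c # w'" by (cases w) auto
    with w restart[of Init "odd c" "q0 (odd c)" c]
    have "foldl ?\<delta> (Inside (odd c) (q0 (odd c))) w \<in> range Completed" by simp
    from parse[OF _ this] w obtain b bs
      where "w = map (letter (odd c)) b @ marker (odd c) # alternating_word (\<not> odd c) bs"
        "b \<in> R (odd c)" "alternating_in R (\<not> odd c) bs"
      by (auto simp: R)
    then show "w \<in> alternating_language R"
      unfolding alternating_language_def
      by (intro CollectI exI[of _ "odd c"] exI[of _ "b # bs"]) (auto simp: block_def)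
  qed
  moreover have "regular_language ?A {w \<in> lists ?A. foldl ?\<delta> Init w \<in> range Completed}"
  proof (rule regular_languageI)
    show "finite S" "Init \<in> S" "range Completed \<subseteq> S" using finQ by (auto simp: S_def)
    fix s c assume "s \<in> S" "c \<in> ?A"
    from this(2) show "?\<delta> s c \<in> S"
      using \<open>s \<in> S\<close> q0 closed
      by (cases rule: free_product_alphabet_cases; cases s)
        (auto simp: alternation_step_marker alternation_step_letter S_iff
          split: option.splits if_splits)
  qed
  ultimately show ?thesis by simp
qed

section \<open>Normal forms in the free product\<close>

text \<open>Indexing by \<open>bool\<close> makes \<open>\<not> i\<close> the other factor, so each
  argument is given once for both sides. The monoid structure enters through the empty word:
  \<open>\<pi>_append\<close> covers it, and since \<open>\<pi> i\<close> is onto,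
  \<open>\<pi> i []\<close> is an identity of the factor.\<close>

locale free_product_combing =
  fixes A :: "bool \<Rightarrow> 'x set" and \<R> :: "bool \<Rightarrow> ('x list \<times> 'x list) set"
    and B :: "bool \<Rightarrow> nat set" and \<pi> :: "bool \<Rightarrow> nat list \<Rightarrow> 'x list set"
    and R :: "bool \<Rightarrow> nat list set"
  assumes pres: "presentation (A i) (\<R> i)"
    and disjoint: "A False \<inter> A True = {}"
    and finite_B: "finite (B i)"
    and \<pi>_closed: "w \<in> lists (B i) \<Longrightarrow> \<pi> i w \<in> carrier (Sgp (A i) (\<R> i))"
    and \<pi>_append: "\<lbrakk>u \<in> lists (B i); v \<in> lists (B i)\<rbrakk>
          \<Longrightarrow> \<pi> i (u @ v) = \<pi> i u \<otimes>\<^bsub>Sgp (A i) (\<R> i)\<^esub> \<pi> i v"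
    and R_subset: "R i \<subseteq> lists (B i)"
    and regular_R: "regular_language (B i) (R i)"
    and \<pi>_image_R: "\<pi> i ` R i = carrier (Sgp (A i) (\<R> i))"
    and context_free_table: "context_free (multiplication_table (\<pi> i) (R i))"
begin

abbreviation S where "S i \<equiv> Sgp (A i) (\<R> i)"

abbreviation cls where "cls i u \<equiv> generated_congruence (A i) (\<R> i) `` {u}"

abbreviation free_letters where "free_letters \<equiv> A False \<union> A True"

abbreviation free_cong where "free_cong \<equiv> generated_congruence free_letters (\<R> False \<union> \<R> True)"

lemma in_lists_B: "u \<in> R i \<Longrightarrow> u \<in> lists (B i)"
  using R_subset by blast

lemma presentation_free: "presentation free_letters (\<R> False \<union> \<R> True)"
  using pres[of False] pres[of True] by (auto simp: presentation_def plus_words_def)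

lemma equiv_free_cong: "equiv (plus_words free_letters) free_cong"
  using equiv_generated_congruence[OF presentation_free] .

lemma cong_imp_free_cong:
  "(u, v) \<in> generated_congruence (A i) (\<R> i) \<Longrightarrow> (u, v) \<in> free_cong"
proof (induction rule: generated_congruence.induct)
  case (refl w)
  then show ?case by (cases i) (auto simp: plus_words_def intro!: generated_congruence.refl)
qed (cases i; auto intro: generated_congruence.intros)+

lemma S_cases:
  assumes "X \<in> carrier (S i)"
  obtains u where "u \<in> plus_words (A i)" "X = cls i u"
  using assms by (auto simp: Sgp_def elim: quotientE)

lemma cls_in_S: "u \<in> plus_words (A i) \<Longrightarrow> cls i u \<in> carrier (S i)"
  by (auto simp: Sgp_def intro: quotientI)

lemma S_closed: "X \<in> carrier (S i) \<Longrightarrow> Y \<in> carrier (S i) \<Longrightarrow> X \<otimes>\<^bsub>S i\<^esub> Y \<in> carrier (S i)"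
  using alg_semigroup.m_closed[OF alg_semigroup_Sgp[OF pres]] .

lemma cls_append:
  "u \<in> plus_words (A i) \<Longrightarrow> v \<in> plus_words (A i) \<Longrightarrow> cls i (u @ v) = cls i u \<otimes>\<^bsub>S i\<^esub> cls i v"
  using Sgp_mult_class[OF pres] by simp

text \<open>Words act on sequences of elements of the factors by \<open>push\<close>; congruent words act alike, and
  \<open>act w []\<close> is the normal form of \<open>w\<close>.\<close>

definition push :: "bool \<Rightarrow> 'x list set \<Rightarrow> (bool \<times> 'x list set) list \<Rightarrow> (bool \<times> 'x list set) list" where
  "push i X ys = (case ys of [] \<Rightarrow> [(i, X)]
     | (j, Y) # zs \<Rightarrow> if j = i then (i, X \<otimes>\<^bsub>S i\<^esub> Y) # zs else (i, X) # ys)"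

definition side :: "'x \<Rightarrow> bool" where
  "side x \<longleftrightarrow> x \<in> A True"

definition act :: "'x list \<Rightarrow> (bool \<times> 'x list set) list \<Rightarrow> (bool \<times> 'x list set) list" where
  "act w = foldr (\<lambda>x. push (side x) (cls (side x) [x])) w"

definition factor_seq :: "(bool \<times> 'x list set) list \<Rightarrow> bool" where
  "factor_seq ys \<longleftrightarrow> (\<forall>(i, X)\<in>set ys. X \<in> carrier (S i))"

lemma side_eq: "x \<in> A i \<Longrightarrow> side x = i"
  using disjoint by (cases i) (auto simp: side_def)

lemma act_Nil [simp]: "act [] ys = ys"
  and act_Cons: "act (x # w) ys = push (side x) (cls (side x) [x]) (act w ys)"
  and act_append: "act (u @ v) ys = act u (act v ys)"
  by (simp_all add: act_def)

lemma factor_seq_Nil [simp]: "factor_seq []"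
  and factor_seq_Cons [simp]: "factor_seq ((i, X) # ys) \<longleftrightarrow> X \<in> carrier (S i) \<and> factor_seq ys"
  by (auto simp: factor_seq_def)

lemma factor_seq_push: "X \<in> carrier (S i) \<Longrightarrow> factor_seq ys \<Longrightarrow> factor_seq (push i X ys)"
  by (auto simp: push_def S_closed split: list.splits)

text \<open>Associativity in the factor, when the head of \<open>ys\<close> has side
  \<open>i\<close>. It makes pushing on one side an action of that factor.\<close>

lemma push_push:
  assumes "X \<in> carrier (S i)" "Y \<in> carrier (S i)" "factor_seq ys"
  shows "push i X (push i Y ys) = push i (X \<otimes>\<^bsub>S i\<^esub> Y) ys"
  using assms alg_semigroup.m_assoc[OF alg_semigroup_Sgp[OF pres]]
  by (auto simp: push_def split: list.splits)

lemma push_other: "ys = [] \<or> fst (hd ys) \<noteq> i \<Longrightarrow> push i X ys = (i, X) # ys"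
  by (auto simp: push_def split: list.splits)

text \<open>The pushes of the single letters fuse by \<open>push_push\<close>, so a word of one
  factor acts through its class alone.\<close>

lemma act_factor_word:
  assumes "u \<in> plus_words (A i)" "factor_seq ys"
  shows "act u ys = push i (cls i u) ys"
proof -
  from assms(1) have "u \<noteq> []" "u \<in> lists (A i)" by (auto simp: plus_words_def)
  then show ?thesis
  proof (induction u rule: list_nonempty_induct)
    case (single x)
    then show ?case by (simp add: act_Cons side_eq)
  next
    case (cons x u)
    then have "[x] \<in> plus_words (A i)" "u \<in> plus_words (A i)" "side x = i"
      by (auto simp: plus_words_def side_eq)
    with cons assms(2) show ?case
      using cls_append[of "[x]" i u] by (simp add: act_Cons push_push cls_in_S)
  qed
qed

lemma factor_seq_act:
  assumes "w \<in> lists free_letters" "factor_seq ys"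
  shows "factor_seq (act w ys)"
  using assms(1)
proof (induction w)
  case (Cons x w)
  then have "[x] \<in> plus_words (A (side x))" "factor_seq (act w ys)"
    by (auto simp: plus_words_def side_eq)
  then show ?case by (simp add: act_Cons factor_seq_push cls_in_S)
qed (use assms in simp)

text \<open>Van der Waerden's method. Each defining relation belongs to one factor, and words of a
  factor act through their classes; concatenation becomes composition of actions, which is why
  \<open>ys\<close> has to vary.\<close>

lemma act_cong: "(u, v) \<in> free_cong \<Longrightarrow> factor_seq ys \<Longrightarrow> act u ys = act v ys"
proof (induction arbitrary: ys rule: generated_congruence.induct)
  case (base u v)
  then obtain i where "(u, v) \<in> \<R> i" by blast
  then have uv: "(u, v) \<in> generated_congruence (A i) (\<R> i)" by (rule generated_congruence.base)
  then have "u \<in> plus_words (A i)" "v \<in> plus_words (A i)"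
    using generated_congruence_words[OF pres] by blast+
  moreover have "cls i u = cls i v"
    using uv by (rule equiv_class_eq[OF equiv_generated_congruence[OF pres]])
  ultimately show ?case using base by (simp add: act_factor_word)
next
  case (mult u v u' v')
  then have "v' \<in> lists free_letters"
    using generated_congruence_words[OF presentation_free] by (auto simp: plus_words_def)
  with mult show ?case by (simp add: act_append factor_seq_act)
qed auto

text \<open>A way back from sequences to words. The chosen representatives are arbitrary, so it
  inverts \<open>act\<close> only up to congruence.\<close>

definition flatten :: "(bool \<times> 'x list set) list \<Rightarrow> 'x list" where
  "flatten ys = concat (map (\<lambda>(i, X). SOME a. a \<in> X) ys)"

lemma some_in_factor:
  assumes "X \<in> carrier (S i)"
  shows "(SOME a. a \<in> X) \<in> X"
proof -
  obtain u where "u \<in> plus_words (A i)" "X = cls i u" using S_cases[OF assms] .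
  then have "u \<in> X" by (simp add: generated_congruence.refl)
  then show ?thesis by (rule someI)
qed

lemma factor_elem_word:
  assumes "X \<in> carrier (S i)" "a \<in> X"
  shows "a \<in> plus_words (A i)" "X = cls i a"
proof -
  obtain u where u: "u \<in> plus_words (A i)" "X = cls i u" using S_cases[OF assms(1)] .
  with assms(2) have "(u, a) \<in> generated_congruence (A i) (\<R> i)" by simp
  then show "a \<in> plus_words (A i)" "X = cls i a"
    using generated_congruence_words[OF pres] u(2)
      equiv_class_eq[OF equiv_generated_congruence[OF pres]] by blast+
qed

lemma flatten_in_lists: "factor_seq ys \<Longrightarrow> flatten ys \<in> lists free_letters"
proof (induction ys)
  case (Cons y ys)
  obtain i X where y: "y = (i, X)" by force
  with Cons.prems have "(SOME a. a \<in> X) \<in> plus_words (A i)"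
    using factor_elem_word(1)[of X i] some_in_factor[of X i] by simp
  with y Cons show ?case by (cases i) (auto simp: flatten_def plus_words_def)
qed (simp add: flatten_def)

lemma free_cong_append_right:
  assumes "(u, v) \<in> free_cong" "s \<in> lists free_letters"
  shows "(u @ s, v @ s) \<in> free_cong"
proof (cases "s = []")
  case False
  with assms(2) have "(s, s) \<in> free_cong"
    by (intro generated_congruence.refl) (auto simp: plus_words_def)
  with assms(1) show ?thesis by (rule generated_congruence.mult)
qed (use assms in simp)

text \<open>Without fusion, \<open>a\<close> is exchanged for the chosen representative of the same
  class. With fusion, \<open>a\<close> followed by the representative of the old head lies in the
  product class and is exchanged for the representative chosen there.\<close>

lemma flatten_push:
  assumes "X \<in> carrier (S i)" "a \<in> X" "factor_seq ys"
  shows "(a @ flatten ys, flatten (push i X ys)) \<in> free_cong"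
proof -
  have same: "(u @ s, (SOME a. a \<in> Y) @ s) \<in> free_cong"
    if "Y \<in> carrier (S i)" "u \<in> Y" "s \<in> lists free_letters" for Y u s
  proof -
    have "(u, SOME a. a \<in> Y) \<in> generated_congruence (A i) (\<R> i)"
      using some_in_factor[OF that(1)] factor_elem_word[OF that(1,2)] by blast
    then show ?thesis using that(3) by (intro free_cong_append_right cong_imp_free_cong)
  qed
  show ?thesis
  proof (cases "ys = [] \<or> fst (hd ys) \<noteq> i")
    case True
    then show ?thesis
      using same[OF assms(1,2) flatten_in_lists[OF assms(3)]]
      by (simp add: push_other flatten_def)
  next
    case False
    then obtain Y zs where ys: "ys = (i, Y) # zs" by (cases ys) auto
    with assms have Y: "Y \<in> carrier (S i)" "factor_seq zs" by simp_all
    let ?y = "SOME a. a \<in> Y"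
    have words: "a \<in> plus_words (A i)" "X = cls i a" "?y \<in> plus_words (A i)" "Y = cls i ?y"
      using factor_elem_word[OF assms(1,2)] factor_elem_word[OF Y(1) some_in_factor[OF Y(1)]]
      by simp_all
    then have "X \<otimes>\<^bsub>S i\<^esub> Y = cls i (a @ ?y)" by (metis cls_append)
    then have "a @ ?y \<in> X \<otimes>\<^bsub>S i\<^esub> Y"
      using words by (simp add: generated_congruence.refl append_plus_words)
    from same[OF S_closed[OF assms(1) Y(1)] this flatten_in_lists[OF Y(2)]]
    show ?thesis by (simp add: ys push_def flatten_def)
  qed
qed

lemma free_cong_flatten_act:
  assumes "w \<in> plus_words free_letters"
  shows "(w, flatten (act w [])) \<in> free_cong"
proof -
  from assms have "w \<noteq> []" "w \<in> lists free_letters" by (auto simp: plus_words_def)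
  then show ?thesis
  proof (induction w rule: list_nonempty_induct)
    case (single x)
    then have "[x] \<in> plus_words (A (side x))" by (auto simp: plus_words_def side_eq)
    then show ?case
      using flatten_push[of "cls (side x) [x]" "side x" "[x]" "[]"]
      by (simp add: act_Cons flatten_def cls_in_S generated_congruence.refl)
  next
    case (cons x w)
    then have x: "[x] \<in> plus_words (A (side x))" and "x \<in> free_letters"
      by (auto simp: plus_words_def side_eq)
    then have "([x], [x]) \<in> free_cong"
      by (intro generated_congruence.refl) (auto simp: plus_words_def)
    with cons have "([x] @ w, [x] @ flatten (act w [])) \<in> free_cong"
      by (intro generated_congruence.mult) auto
    moreover have "([x] @ flatten (act w []), flatten (act (x # w) [])) \<in> free_cong"
      using x cons unfolding act_Cons
      by (intro flatten_push factor_seq_act) (auto simp: cls_in_S generated_congruence.refl)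
    ultimately show ?case by (auto intro: generated_congruence.trans)
  qed
qed

text \<open>Congruent words act alike, and conversely every word is congruent to the flattening of
  its normal form.\<close>

lemma free_cong_iff_act:
  assumes "u \<in> plus_words free_letters" "v \<in> plus_words free_letters"
  shows "(u, v) \<in> free_cong \<longleftrightarrow> act u [] = act v []"
  using act_cong[of u v "[]"] free_cong_flatten_act[OF assms(1)] free_cong_flatten_act[OF assms(2)]
  by (metis factor_seq_Nil generated_congruence.sym generated_congruence.trans)

section \<open>Values of words over the new alphabet\<close>

text \<open>The new letters name elements of the factors, not generators of the presentation, so
  each is sent to a chosen word of its class. Parity selects the factor, and
  \<open>c div 2 = 0\<close> recognises a marker, which is sent to a word for the identity.\<close>

definition letter_word :: "nat \<Rightarrow> 'x list" where
  "letter_word c = (SOME u. u \<in> \<pi> (odd c) (if c div 2 = 0 then [] else [c div 2 - 1]))"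

definition free_word :: "nat list \<Rightarrow> 'x list" where
  "free_word w = concat (map letter_word w)"

definition free_value :: "nat list \<Rightarrow> 'x list set" where
  "free_value w = free_cong `` {free_word w}"

lemma letter_word_marker:
  "letter_word (marker i) \<in> plus_words (A i)" "cls i (letter_word (marker i)) = \<pi> i []"
proof -
  have "\<pi> i [] \<in> carrier (S i)" by (simp add: \<pi>_closed)
  from factor_elem_word[OF this some_in_factor[OF this]]
  show "letter_word (marker i) \<in> plus_words (A i)" "cls i (letter_word (marker i)) = \<pi> i []"
    by (simp_all add: letter_word_def)
qed

lemma letter_word_letter:
  assumes "a \<in> B i"
  shows "letter_word (letter i a) \<in> plus_words (A i)"
    "cls i (letter_word (letter i a)) = \<pi> i [a]"
proof -
  have "\<pi> i [a] \<in> carrier (S i)" using assms by (simp add: \<pi>_closed)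
  from factor_elem_word[OF this some_in_factor[OF this]]
  show "letter_word (letter i a) \<in> plus_words (A i)"
    "cls i (letter_word (letter i a)) = \<pi> i [a]"
    by (simp_all add: letter_word_def)
qed

lemma letter_word_in_plus_words:
  assumes "c \<in> free_product_alphabet B"
  shows "letter_word c \<in> plus_words free_letters"
proof -
  have sub: "plus_words (A i) \<subseteq> plus_words free_letters" for i
    by (cases i) (auto simp: plus_words_def)
  from assms show ?thesis
    by (cases rule: free_product_alphabet_cases) (use letter_word_marker letter_word_letter sub in blast)+
qed

lemma free_word_in_plus_words:
  assumes "w \<in> plus_words (free_product_alphabet B)"
  shows "free_word w \<in> plus_words free_letters"
proof -
  from assms have "w \<noteq> []" "w \<in> lists (free_product_alphabet B)" by (auto simp: plus_words_def)
  then show ?thesis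
  proof (induction w rule: list_nonempty_induct)
    case (single c)
    then show ?case by (simp add: free_word_def letter_word_in_plus_words)
  next
    case (cons c w)
    then show ?case
      using append_plus_words[OF letter_word_in_plus_words[of c], of "free_word w"]
      by (simp add: free_word_def)
  qed
qed

lemma free_word_append [simp]: "free_word (u @ v) = free_word u @ free_word v"
  by (simp add: free_word_def)

text \<open>The marker pushes the identity \<open>\<pi> i []\<close>; the letters then fuse onto it
  from right to left.\<close>

lemma act_block:
  assumes "b \<in> lists (B i)" "factor_seq ys"
  shows "act (free_word (block i b)) ys = push i (\<pi> i b) ys"
  using assms(1)
proof (induction b)
  case Nil
  then show ?case
    using letter_word_marker[of i] assms(2)
    by (simp add: free_word_def block_def act_factor_word)
next
  case (Cons a b)
  then have a: "[a] \<in> lists (B i)" and b: "b \<in> lists (B i)" by auto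
  have "act (free_word (block i (a # b))) ys =
      act (letter_word (letter i a)) (act (free_word (block i b)) ys)"
    by (simp add: free_word_def block_def act_append)
  also have "\<dots> = push i (\<pi> i [a]) (push i (\<pi> i b) ys)"
    using a b Cons.IH letter_word_letter[of a i] assms(2)
    by (simp add: act_factor_word factor_seq_push \<pi>_closed)
  also have "\<dots> = push i (\<pi> i (a # b)) ys"
    using a b \<pi>_append[OF a b] assms(2) by (simp add: push_push \<pi>_closed)
  finally show ?case .
qed

fun factors :: "bool \<Rightarrow> nat list list \<Rightarrow> (bool \<times> 'x list set) list" where
  "factors i [] = []"
| "factors i (b # bs) = (i, \<pi> i b) # factors (\<not> i) bs"

text \<open>Here a fusion can occur only at the last block of the list: every earlier block is
  pushed onto a sequence whose head has the other side.\<close>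

fun push_factors ::
  "bool \<Rightarrow> nat list list \<Rightarrow> (bool \<times> 'x list set) list \<Rightarrow> (bool \<times> 'x list set) list" where
  "push_factors i [] ys = ys"
| "push_factors i (b # bs) ys = push i (\<pi> i b) (push_factors (\<not> i) bs ys)"

lemma factors_eq_Nil_iff [simp]: "factors i bs = [] \<longleftrightarrow> bs = []"
  "[] = factors i bs \<longleftrightarrow> bs = []"
  by (cases bs; simp)+

lemma hd_factors: "bs \<noteq> [] \<Longrightarrow> fst (hd (factors i bs)) = i"
  by (cases bs) auto

lemma push_other_factors [simp]: "push i X (factors (\<not> i) bs) = (i, X) # factors (\<not> i) bs"
  using hd_factors[of bs "\<not> i"] by (cases "bs = []") (auto simp: push_other)

lemma push_eq_Cons: "\<exists>Y zs. push i X ys = (i, Y) # zs"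
  by (auto simp: push_def split: list.splits)

lemma factor_seq_factors: "alternating_in R i bs \<Longrightarrow> factor_seq (factors i bs)"
  by (induction bs arbitrary: i) (auto simp: \<pi>_closed in_lists_B)

lemma factor_seq_push_factors:
  "alternating_in R i bs \<Longrightarrow> factor_seq ys \<Longrightarrow> factor_seq (push_factors i bs ys)"
  by (induction bs arbitrary: i)
    (auto simp: \<pi>_closed in_lists_B intro!: factor_seq_push)

lemma push_factors_Nil: "push_factors i bs [] = factors i bs"
  by (induction bs arbitrary: i) simp_all

lemma act_alternating_word:
  "alternating_in R i bs \<Longrightarrow> factor_seq ys \<Longrightarrow>
     act (free_word (alternating_word i bs)) ys = push_factors i bs ys"
proof (induction bs arbitrary: i)
  case (Cons b bs)
  then show ?case
    by (simp add: act_append act_block in_lists_B factor_seq_push_factors)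
qed (simp add: free_word_def)

lemma free_value_eq_iff:
  assumes "u \<in> plus_words (free_product_alphabet B)" "v \<in> plus_words (free_product_alphabet B)"
  shows "free_value u = free_value v \<longleftrightarrow> act (free_word u) [] = act (free_word v) []"
  using free_word_in_plus_words[OF assms(1)] free_word_in_plus_words[OF assms(2)]
  unfolding free_value_def
  by (simp add: eq_equiv_class_iff[OF equiv_free_cong] free_cong_iff_act)

lemma alternating_word_in_plus_words:
  "bs \<noteq> [] \<Longrightarrow> alternating_in R i bs \<Longrightarrow>
     alternating_word i bs \<in> plus_words (free_product_alphabet B)"
  using alternating_language_subset[of R B] R_subset by (auto simp: alternating_language_def)

text \<open>Membership in the table of the free product becomes an equation between sequences, which
  the grammar can check pair by pair.\<close>

lemma free_value_mult_iff:
  assumes "bs \<noteq> []" "alternating_in R i bs" "cs \<noteq> []" "alternating_in R j cs"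
    "ds \<noteq> []" "alternating_in R k ds"
  shows "free_value (alternating_word i bs @ alternating_word j cs) =
      free_value (alternating_word k ds) \<longleftrightarrow> push_factors i bs (factors j cs) = factors k ds"
  using assms
  by (subst free_value_eq_iff)
    (auto simp: append_plus_words alternating_word_in_plus_words act_append act_alternating_word
      factor_seq_factors push_factors_Nil)

text \<open>Whatever element heads the sequence after the push, fused or new, it has a
  representative in \<open>R i\<close> because the combing maps onto the factor.\<close>

lemma push_in_factors:
  assumes "X \<in> carrier (S i)" "alternating_in R j bs"
  shows "\<exists>bs'. bs' \<noteq> [] \<and> alternating_in R i bs' \<and> push i X (factors j bs) = factors i bs'"
proof (cases "bs \<noteq> [] \<and> j = i")
  case True
  then obtain b bs' where bs: "bs = b # bs'" by (cases bs) auto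
  with True assms have "X \<otimes>\<^bsub>S i\<^esub> \<pi> i b \<in> carrier (S i)"
    by (simp add: S_closed \<pi>_closed in_lists_B)
  then obtain b' where "b' \<in> R i" "\<pi> i b' = X \<otimes>\<^bsub>S i\<^esub> \<pi> i b"
    using \<pi>_image_R[of i] by (metis imageE)
  with bs True assms show ?thesis
    by (intro exI[of _ "b' # bs'"]) (simp add: push_def)
next
  case False
  obtain b where b: "b \<in> R i" "\<pi> i b = X"
    using \<pi>_image_R[of i] assms(1) by (metis imageE)
  show ?thesis
  proof (cases "bs = []")
    case True
    with b show ?thesis by (intro exI[of _ "[b]"]) (simp add: push_def)
  next
    case F: False
    with False have "j = (\<not> i)" by simp
    with b assms(2) show ?thesis by (intro exI[of _ "b # bs"]) simp
  qed
qed

lemma act_in_factors: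
  assumes "w \<in> plus_words free_letters"
  shows "\<exists>i bs. bs \<noteq> [] \<and> alternating_in R i bs \<and> act w [] = factors i bs"
proof -
  have cls: "x \<in> free_letters \<Longrightarrow> cls (side x) [x] \<in> carrier (S (side x))" for x
    by (rule cls_in_S) (auto simp: plus_words_def side_eq)
  from assms have "w \<noteq> []" "w \<in> lists free_letters" by (auto simp: plus_words_def)
  then show ?thesis
  proof (induction w rule: list_nonempty_induct)
    case (single x)
    \<comment> \<open>The empty sequence alternates from either side, so its side may be
      arbitrary.\<close>
    then show ?case
      using push_in_factors[OF cls, of x undefined "[]"] by (auto simp: act_Cons)
  next
    case (cons x w)
    then obtain i bs where "alternating_in R i bs" "act w [] = factors i bs" by auto
    with cons.prems show ?case
      using push_in_factors[OF cls, of x i bs] by (auto simp: act_Cons)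
  qed
qed

lemma free_value_epi:
  "free_value \<in> epi (free_semigroup (free_product_alphabet B)) (Sgp free_letters (\<R> False \<union> \<R> True))"
  and free_value_image:
  "free_value ` alternating_language R = carrier (Sgp free_letters (\<R> False \<union> \<R> True))"
proof -
  let ?A = "free_product_alphabet B" and ?F = "Sgp free_letters (\<R> False \<union> \<R> True)"
  have closed: "free_value w \<in> carrier ?F" if "w \<in> plus_words ?A" for w
    using free_word_in_plus_words[OF that] by (auto simp: free_value_def Sgp_def intro: quotientI)
  have "free_value (u @ v) = free_value u \<otimes>\<^bsub>?F\<^esub> free_value v"
    if "u \<in> plus_words ?A" "v \<in> plus_words ?A" for u v
    using Sgp_mult_class[OF presentation_free] that
    by (simp add: free_value_def free_word_in_plus_words)
  then have hom: "free_value \<in> hom (free_semigroup ?A) ?F"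
    using closed by (auto simp: hom_def free_semigroup_def)
  have sub: "alternating_language R \<subseteq> plus_words ?A"
    using alternating_language_subset R_subset by blast
  have surj: "X \<in> free_value ` alternating_language R" if "X \<in> carrier ?F" for X
  proof -
    from that obtain w where w: "w \<in> plus_words free_letters" "X = free_cong `` {w}"
      by (auto simp: Sgp_def elim: quotientE)
    then obtain i bs where bs: "bs \<noteq> []" "alternating_in R i bs" "act w [] = factors i bs"
      using act_in_factors by blast
    let ?v = "alternating_word i bs"
    have v: "free_word ?v \<in> plus_words free_letters"
      using bs free_word_in_plus_words alternating_word_in_plus_words by blast
    \<comment> \<open>The word \<open>?v\<close> is read off from the normal form of
      \<open>w\<close>, so the two normal forms agree.\<close>
    have "(w, free_word ?v) \<in> free_cong"
      using bs by (simp add: free_cong_iff_act[OF w(1) v] act_alternating_word push_factors_Nil)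
    then have "X = free_value ?v"
      unfolding w(2) free_value_def by (rule equiv_class_eq[OF equiv_free_cong])
    moreover have "?v \<in> alternating_language R"
      using bs by (auto simp: alternating_language_def)
    ultimately show ?thesis by blast
  qed
  show "free_value ` alternating_language R = carrier ?F"
    using surj sub closed by blast
  then show "free_value \<in> epi (free_semigroup ?A) ?F"
    using hom image_mono[OF sub, of free_value] unfolding epi_iff_subset by (auto simp: free_semigroup_def)
qed

end

section \<open>The multiplication table\<close>

text \<open>\<open>Front i\<close> derives the part of a table word from a block of side \<open>i\<close> in the first factor
  onwards, and \<open>Back i\<close> the same once \<open>#\<^sub>1\<close> has been passed; both include the matching end of
  \<open>w\<^sup>r\<^sup>e\<^sup>v\<close>.\<close>

datatype table_nonterminal = Start | Front bool | Back bool

instance table_nonterminal :: finite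
proof
  have "x \<in> {Start} \<union> range Front \<union> range Back" for x :: table_nonterminal
    by (cases x) auto
  then have "(UNIV :: table_nonterminal set) \<subseteq> {Start} \<union> range Front \<union> range Back"
    by blast
  then show "finite (UNIV :: table_nonterminal set)"
    by (rule finite_subset) simp
qed

datatype table_state = Left | Skip "nat list" | Middle | Right

instance table_state :: countable
  by countable_datatype

instance marked :: (countable) countable
  by countable_datatype

type_synonym table_sym = "(table_nonterminal, nat marked) sym"

definition letters_of :: "nat list \<Rightarrow> table_sym list" where
  "letters_of w = map (\<lambda>c. Tm (Letter c)) w"

text \<open>\<open>Xs\<close> are the possible centres when the two blocks meet as equal elements, \<open>Ys\<close> those when
  two blocks of the same side are multiplied.\<close>

definition table_rules ::
  "(nat list \<Rightarrow> 's) \<Rightarrow> nat list set \<Rightarrow> bool \<Rightarrow> table_sym list set \<Rightarrow> table_sym list set \<Rightarrow>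
     table_sym list set" where
  "table_rules p R i Xs Ys =
     {letters_of (block i u) @ X @ letters_of (rev (block i w)) | u w X.
        u \<in> R \<and> w \<in> R \<and> p u = p w \<and> X \<in> Xs} \<union>
     {letters_of (block i u) @ [Tm Hash1] @ letters_of (block i v) @ X @
        letters_of (rev (block i w)) | u v w X.
        u \<in> R \<and> v \<in> R \<and> w \<in> R \<and> p (u @ v) = p w \<and> X \<in> Ys}"

text \<open>The states \<open>Skip r\<close> read the fixed word \<open>e\<close> between \<open>#\<^sub>1\<close> and \<open>#\<^sub>2\<close>, which turns the
  table into the set of pairs of words with equal values.\<close>

definition table_transducer ::
  "nat set \<Rightarrow> bool \<Rightarrow> nat list \<Rightarrow> table_sym list set \<Rightarrow> table_sym list set \<Rightarrow>
     (table_state \<times> nat marked \<times> table_sym list \<times> table_state) set" where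
  "table_transducer B i e Xs Ys =
     (\<Union>q\<in>{Left, Middle, Right}. (\<lambda>a. (q, Letter a, letters_of [letter i a], q)) ` B) \<union>
     {(Left, Hash1, letters_of [marker i], Skip e),
      (Left, Hash1, letters_of [marker i] @ [Tm Hash1], Middle)} \<union>
     {(Skip (a # r), Letter a, [], Skip r) | a r. suffix (a # r) e} \<union>
     (\<lambda>X. (Skip [], Hash2, X @ letters_of [marker i], Right)) ` Xs \<union>
     (\<lambda>X. (Middle, Hash2, letters_of [marker i] @ X @ letters_of [marker i], Right)) ` Ys"

lemma finite_table_transducer:
  assumes "finite B" "finite Xs" "finite Ys"
  shows "finite (table_transducer B i e Xs Ys)"
proof -
  have "{(Skip (a # r), Letter a, [] :: table_sym list, Skip r) | a r. suffix (a # r) e} \<subseteq>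
      (\<lambda>(a, r). (Skip (a # r), Letter a, [], Skip r)) ` (set e \<times> set (suffixes e))"
    by (auto simp: image_iff suffix_def)
  then have "finite {(Skip (a # r), Letter a, [] :: table_sym list, Skip r) | a r. suffix (a # r) e}"
    by (rule finite_subset) simp
  then show ?thesis
    unfolding table_transducer_def using assms by simp
qed

lemma run_loop_iff:
  assumes "\<And>a y q'. (q, Letter a, y, q') \<in> \<delta> \<longleftrightarrow> a \<in> B \<and> y = letters_of [letter i a] \<and> q' = q"
  shows "run \<delta> q (map Letter u @ x) v q1 \<longleftrightarrow>
    u \<in> lists B \<and> (\<exists>v'. v = letters_of (map (letter i) u) @ v' \<and> run \<delta> q x v' q1)"
proof (induction u arbitrary: v)
  case (Cons a u)
  show ?case
    by (auto simp: run_simps(2) Cons.IH assms letters_of_def)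
qed (simp add: letters_of_def)

lemma run_skip_iff:
  assumes "suffix r e"
  shows "run (table_transducer B i e Xs Ys) (Skip r) (map Letter v @ Hash2 # x) z q1 \<longleftrightarrow>
    v = r \<and> run (table_transducer B i e Xs Ys) (Skip []) (Hash2 # x) z q1"
  using assms
proof (induction v arbitrary: r)
  case Nil
  then show ?case
    by (cases r) (auto simp: run_simps table_transducer_def)
next
  case (Cons a v)
  let ?\<delta> = "table_transducer B i e Xs Ys"
  have "(Skip r, Letter a, y, q) \<in> ?\<delta> \<longleftrightarrow> (\<exists>r'. r = a # r' \<and> y = [] \<and> q = Skip r')" for y q
    using Cons.prems by (auto simp: table_transducer_def)
  moreover have "r = a # r' \<Longrightarrow> suffix r' e" for r'
    using Cons.prems by (auto dest: suffix_ConsD)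
  ultimately show ?case
    using Cons.IH by (auto simp: run_simps(2)[of _ _ "Letter a"])
qed

text \<open>One transducer produces both kinds of rules from the factor's table. At
  \<open>Hash1\<close> it guesses whether to check and erase the word \<open>e\<close> or to copy
  the second word; at \<open>Hash2\<close> it inserts the centre. The markers of the blocks are
  emitted at these two separators.\<close>

lemma context_free_table_rules:
  assumes "context_free (multiplication_table p R)" "R \<subseteq> lists B" "finite B"
    and p_append: "\<And>u v. u \<in> lists B \<Longrightarrow> v \<in> lists B \<Longrightarrow> p (u @ v) = f (p u) (p v)"
    and e: "e \<in> R" "p e = p []"
    and fin: "finite Xs" "finite Ys"
  shows "context_free (table_rules p R i Xs Ys)"
proof -
  let ?\<delta> = "table_transducer B i e Xs Ys"
  let ?Q = "{Left, Middle, Right} \<union> Skip ` set (suffixes e)"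
  have left: "(Left, Letter a, y, q') \<in> ?\<delta> \<longleftrightarrow> a \<in> B \<and> y = letters_of [letter i a] \<and> q' = Left"
    and middle: "(Middle, Letter a, y, q') \<in> ?\<delta> \<longleftrightarrow> a \<in> B \<and> y = letters_of [letter i a] \<and> q' = Middle"
    and right: "(Right, Letter a, y, q') \<in> ?\<delta> \<longleftrightarrow> a \<in> B \<and> y = letters_of [letter i a] \<and> q' = Right"
    for a y q'
    by (auto simp: table_transducer_def)
  have hash_left: "run ?\<delta> Left (Hash1 # s) z q \<longleftrightarrow>
      (\<exists>x. z = letters_of [marker i] @ x \<and> run ?\<delta> (Skip e) s x q) \<or>
      (\<exists>x. z = letters_of [marker i] @ [Tm Hash1] @ x \<and> run ?\<delta> Middle s x q)" for s z q
  proof -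
    have "(Left, Hash1, y, q') \<in> ?\<delta> \<longleftrightarrow> y = letters_of [marker i] \<and> q' = Skip e \<or>
        y = letters_of [marker i] @ [Tm Hash1] \<and> q' = Middle" for y q'
      by (auto simp: table_transducer_def)
    then show ?thesis unfolding run_simps(2) by (metis append.assoc)
  qed
  have hash_skip: "run ?\<delta> (Skip []) (Hash2 # s) z q \<longleftrightarrow>
      (\<exists>X\<in>Xs. \<exists>x. z = X @ letters_of [marker i] @ x \<and> run ?\<delta> Right s x q)" for s z q
  proof -
    have "(Skip [], Hash2, y, q') \<in> ?\<delta> \<longleftrightarrow>
        (\<exists>X\<in>Xs. y = X @ letters_of [marker i]) \<and> q' = Right" for y q'
      by (auto simp: table_transducer_def)
    then show ?thesis unfolding run_simps(2) by (metis append.assoc)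
  qed
  have hash_middle: "run ?\<delta> Middle (Hash2 # s) z q \<longleftrightarrow>
      (\<exists>X\<in>Ys. \<exists>x. z = letters_of [marker i] @ X @ letters_of [marker i] @ x \<and>
        run ?\<delta> Right s x q)" for s z q
  proof -
    have "(Middle, Hash2, y, q') \<in> ?\<delta> \<longleftrightarrow>
        (\<exists>X\<in>Ys. y = letters_of [marker i] @ X @ letters_of [marker i]) \<and> q' = Right" for y q'
      by (auto simp: table_transducer_def)
    then show ?thesis unfolding run_simps(2) by (metis append.assoc)
  qed
  have run_right: "run ?\<delta> Right (map Letter w) z Right \<longleftrightarrow>
      w \<in> lists B \<and> z = letters_of (map (letter i) w)" for w z
    using run_loop_iff[OF right, of w "[]" z Right] by (simp add: run_simps)
  have letters_of_block: "letters_of (block i u) = letters_of (map (letter i) u) @ letters_of [marker i]"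
    "letters_of (rev (block i u)) = letters_of [marker i] @ letters_of (map (letter i) (rev u))" for u
    by (simp_all add: letters_of_def block_def rev_map)
  have run: "run ?\<delta> Left (map Letter u @ [Hash1] @ map Letter v @ [Hash2] @ map Letter (rev w)) z Right
      \<longleftrightarrow> (v = e \<and> (\<exists>X\<in>Xs. z = letters_of (block i u) @ X @ letters_of (rev (block i w)))) \<or>
        (\<exists>X\<in>Ys. z = letters_of (block i u) @ [Tm Hash1] @ letters_of (block i v) @ X @
           letters_of (rev (block i w)))"
    if "u \<in> lists B" "v \<in> lists B" "w \<in> lists B" for u v w z
  proof -
    have "rev w \<in> lists B" using that(3) by auto
    with that(1,2) show ?thesis
      unfolding run_loop_iff[OF left] append_Cons append_Nil hash_left run_skip_iff[OF suffix_order.refl]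
        run_loop_iff[OF middle] hash_skip hash_middle run_right letters_of_block append.assoc
      by blast
  qed
  \<comment> \<open>Exchanging \<open>p e\<close> for \<open>p []\<close> under \<open>f\<close>
    gives \<open>p (u @ e) = p (u @ [])\<close>.\<close>
  have eq: "p (u @ e) = p u" if "u \<in> lists B" for u
    using p_append[of u e] p_append[of u "[]"] that e assms(2) by auto
  have in_B: "u \<in> lists B" if "u \<in> R" for u
    using that assms(2) by blast
  let ?word = "\<lambda>u v w. map Letter u @ [Hash1] @ map Letter v @ [Hash2] @ map Letter (rev w)"
  have "table_rules p R i Xs Ys = {z. \<exists>x\<in>multiplication_table p R. run ?\<delta> Left x z Right}"
  proof (intro equalityI subsetI CollectI)
    fix z assume "z \<in> table_rules p R i Xs Ys"
    then show "\<exists>x\<in>multiplication_table p R. run ?\<delta> Left x z Right"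
      unfolding table_rules_def
    proof (elim UnE CollectE exE conjE)
      fix u w X assume *: "u \<in> R" "w \<in> R" "p u = p w" "X \<in> Xs"
        "z = letters_of (block i u) @ X @ letters_of (rev (block i w))"
      then have "run ?\<delta> Left (?word u e w) z Right"
        using run[OF in_B in_B in_B, of u e w z] e(1) by blast
      moreover have "?word u e w \<in> multiplication_table p R"
        unfolding multiplication_table_def using * e(1) eq[OF in_B, of u] by auto
      ultimately show ?thesis ..
    next
      fix u v w X assume *: "u \<in> R" "v \<in> R" "w \<in> R" "p (u @ v) = p w" "X \<in> Ys"
        "z = letters_of (block i u) @ [Tm Hash1] @ letters_of (block i v) @ X @
           letters_of (rev (block i w))"
      then have "run ?\<delta> Left (?word u v w) z Right"
        using run[OF in_B in_B in_B, of u v w z] by blast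
      moreover have "?word u v w \<in> multiplication_table p R"
        unfolding multiplication_table_def using * by auto
      ultimately show ?thesis ..
    qed
  next
    fix z assume "z \<in> {z. \<exists>x\<in>multiplication_table p R. run ?\<delta> Left x z Right}"
    then obtain x where x: "x \<in> multiplication_table p R" "run ?\<delta> Left x z Right" by blast
    from x(1) obtain u v w where *: "u \<in> R" "v \<in> R" "w \<in> R" "p (u @ v) = p w" "x = ?word u v w"
      unfolding multiplication_table_def by (elim CollectE exE conjE)
    from x(2) run[OF in_B in_B in_B, of u v w z] *
    consider X where "v = e" "X \<in> Xs" "z = letters_of (block i u) @ X @ letters_of (rev (block i w))"
      | X where "X \<in> Ys" "z = letters_of (block i u) @ [Tm Hash1] @ letters_of (block i v) @ X @
           letters_of (rev (block i w))" by blast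
    then show "z \<in> table_rules p R i Xs Ys"
    proof cases
      case 1
      moreover have "p u = p w" using 1(1) * eq[OF in_B, of u] by simp
      ultimately show ?thesis unfolding table_rules_def using *(1,3) by blast
    next
      case 2
      then show ?thesis unfolding table_rules_def using *(1-4) by blast
    qed
  qed
  moreover have "context_free {z. \<exists>x\<in>multiplication_table p R. run ?\<delta> Left x z Right}"
  proof (rule context_free_transducer[OF assms(1)])
    show "?\<delta> \<subseteq> ?Q \<times> UNIV \<times> UNIV \<times> ?Q"
      by (auto simp: table_transducer_def in_set_suffixes dest: suffix_ConsD)
    show "finite ?\<delta>" by (rule finite_table_transducer[OF assms(3) fin])
  qed auto
  ultimately show ?thesis by simp
qed

section \<open>The grammar of the table and its correctness\<close>

context free_product_combing
begin

text \<open>The second factor has at least one block: after a change of side \<open>Hash1\<close> is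
  followed by \<open>Back\<close> and never directly by \<open>Hash2\<close>, whereas in the product
  rules the block \<open>v\<close> is already there and \<open>Hash2\<close> may follow.
  \<open>Back\<close> has no product rules because at most one pair of blocks is multiplied.\<close>

fun table_grammar :: "table_nonterminal \<Rightarrow> table_sym list set" where
  "table_grammar Start = {[Nt (Front False)], [Nt (Front True)]}"
| "table_grammar (Back i) = table_rules (\<pi> i) (R i) i {[Tm Hash2], [Nt (Back (\<not> i))]} {}"
| "table_grammar (Front i) = table_rules (\<pi> i) (R i) i
     {[Nt (Front (\<not> i))], [Tm Hash1, Nt (Back (\<not> i))]} {[Tm Hash2], [Nt (Back (\<not> i))]}"

definition table_productions where "table_productions = {(N, r). r \<in> table_grammar N}"

lemma context_free_table_grammar: "context_free (table_grammar N)"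
proof -
  have "context_free (table_rules (\<pi> i) (R i) i Xs Ys)" if "finite Xs" "finite Ys" for i Xs Ys
  proof -
    have "\<pi> i [] \<in> \<pi> i ` R i" by (simp add: \<pi>_image_R \<pi>_closed)
    then obtain e where "e \<in> R i" "\<pi> i e = \<pi> i []" by (metis imageE)
    from context_free_table_rules[OF context_free_table R_subset finite_B \<pi>_append this that]
    show ?thesis by simp
  qed
  then show ?thesis by (cases N) (simp_all add: context_free_finite)
qed

lemma yields_letters_of [simp]:
  "yields P (letters_of u @ s) w \<longleftrightarrow> (\<exists>v. w = map Letter u @ v \<and> yields P s v)"
  "yields P (letters_of u) w \<longleftrightarrow> w = map Letter u"
proof -
  have "letters_of u = map Tm (map Letter u)" by (simp add: letters_of_def)
  then show "yields P (letters_of u @ s) w \<longleftrightarrow> (\<exists>v. w = map Letter u @ v \<and> yields P s v)"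
    "yields P (letters_of u) w \<longleftrightarrow> w = map Letter u"
    by (simp_all only: yields_append_iff yields_map_Tm) blast
qed

definition frame :: "bool \<Rightarrow> nat list \<Rightarrow> nat marked list \<Rightarrow> nat list \<Rightarrow> nat marked list" where
  "frame i u x w = map Letter (block i u) @ x @ map Letter (rev (block i w))"

lemma yields_table_rules_iff:
  "(\<exists>r\<in>table_rules p R' i Xs Ys. yields P r x) \<longleftrightarrow>
     (\<exists>u\<in>R'. \<exists>w\<in>R'. p u = p w \<and> (\<exists>X\<in>Xs. \<exists>y. yields P X y \<and> x = frame i u y w)) \<or>
     (\<exists>u\<in>R'. \<exists>v\<in>R'. \<exists>w\<in>R'. p (u @ v) = p w \<and>
        (\<exists>X\<in>Ys. \<exists>y. yields P X y \<and> x = frame i u (Hash1 # map Letter (block i v) @ y) w))"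
proof -
  have "yields P (letters_of (block i u) @ X @ letters_of (rev (block i w))) x \<longleftrightarrow>
      (\<exists>y. yields P X y \<and> x = frame i u y w)" for u w X
    by (auto simp: yields_append_iff[of P X] frame_def)
  moreover have "yields P (letters_of (block i u) @ [Tm Hash1] @ letters_of (block i v) @ X @
        letters_of (rev (block i w))) x \<longleftrightarrow>
      (\<exists>y. yields P X y \<and> x = frame i u (Hash1 # map Letter (block i v) @ y) w)" for u v w X
    by (auto simp: yields_append_iff[of P X] frame_def)
  ultimately show ?thesis
    unfolding table_rules_def bex_Un by (intro arg_cong2[of _ _ _ _ "(\<or>)"]) blast+
qed

lemma yields_Back_iff:
  "yields table_productions [Nt (Back i)] x \<longleftrightarrow>
     (\<exists>u\<in>R i. \<exists>w\<in>R i. \<pi> i u = \<pi> i w \<and> (\<exists>y. x = frame i u y w \<and>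
        (y = [Hash2] \<or> yields table_productions [Nt (Back (\<not> i))] y)))"
proof -
  have "yields table_productions [Nt (Back i)] x \<longleftrightarrow>
      (\<exists>r\<in>table_grammar (Back i). yields table_productions r x)"
    by (auto simp: yields_singleton_iff table_productions_def)
  then show ?thesis
    unfolding table_grammar.simps yields_table_rules_iff by simp blast
qed

lemma yields_Front_iff:
  "yields table_productions [Nt (Front i)] x \<longleftrightarrow>
     (\<exists>u\<in>R i. \<exists>w\<in>R i. \<pi> i u = \<pi> i w \<and> (\<exists>y. x = frame i u y w \<and>
        (yields table_productions [Nt (Front (\<not> i))] y \<or>
         (\<exists>y'. y = Hash1 # y' \<and> yields table_productions [Nt (Back (\<not> i))] y')))) \<or>
     (\<exists>u\<in>R i. \<exists>v\<in>R i. \<exists>w\<in>R i. \<pi> i (u @ v) = \<pi> i w \<and>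
        (\<exists>y. x = frame i u (Hash1 # map Letter (block i v) @ y) w \<and>
        (y = [Hash2] \<or> yields table_productions [Nt (Back (\<not> i))] y)))"
proof -
  have "yields table_productions [Nt (Front i)] x \<longleftrightarrow>
      (\<exists>r\<in>table_grammar (Front i). yields table_productions r x)"
    by (auto simp: yields_singleton_iff table_productions_def)
  then show ?thesis
    unfolding table_grammar.simps yields_table_rules_iff by simp blast
qed

text \<open>Every block contains its marker, so framing lengthens a word strictly; this is the
  measure for the inductions below.\<close>

lemma length_frame: "length y < length (frame i u y w)"
  by (simp add: frame_def block_def)

definition tail_word :: "bool \<Rightarrow> nat list list \<Rightarrow> nat list list \<Rightarrow> nat marked list" where
  "tail_word i cs ds =
     map Letter (alternating_word i cs) @ [Hash2] @ map Letter (rev (alternating_word i ds))"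

text \<open>\<open>ds\<close> shares the side \<open>i\<close> of \<open>bs\<close>, since a
  nonempty first factor determines the first side of the product.\<close>

definition table_word ::
  "bool \<Rightarrow> nat list list \<Rightarrow> bool \<Rightarrow> nat list list \<Rightarrow> nat list list \<Rightarrow> nat marked list" where
  "table_word i bs j cs ds =
     map Letter (alternating_word i bs) @ [Hash1] @ map Letter (alternating_word j cs) @ [Hash2] @
       map Letter (rev (alternating_word i ds))"

definition matching :: "bool \<Rightarrow> nat list list \<Rightarrow> nat list list \<Rightarrow> bool" where
  "matching i bs ds \<longleftrightarrow>
     alternating_in R i bs \<and> alternating_in R i ds \<and> factors i bs = factors i ds"

lemma tail_word_simps:
  "tail_word i [] [] = [Hash2]"
  "tail_word i (c # cs) (d # ds) = frame i c (tail_word (\<not> i) cs ds) d"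
  by (simp_all add: tail_word_def frame_def)

lemma table_word_simps:
  "table_word i (b # bs) j cs (d # ds) = frame i b (table_word (\<not> i) bs j cs ds) d"
  "table_word i [] i cs ds = Hash1 # tail_word i cs ds"
  "table_word (\<not> i) [] i (c # cs) ds = Hash1 # map Letter (block i c) @ tail_word (\<not> i) cs ds"
  by (simp_all add: table_word_def tail_word_def frame_def)

lemma matching_simps:
  "matching i [] ds \<longleftrightarrow> ds = []" "matching i bs [] \<longleftrightarrow> bs = []"
  "matching i (b # bs) (d # ds) \<longleftrightarrow>
     b \<in> R i \<and> d \<in> R i \<and> \<pi> i b = \<pi> i d \<and> matching (\<not> i) bs ds"
  by (auto simp: matching_def)

text \<open>The induction is on the length of the word, as unfolding by
  \<open>yields_Back_iff\<close> exposes a shorter word derived from the other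
  \<open>Back\<close>.\<close>

lemma yields_BackD:
  assumes "yields table_productions [Nt (Back i)] x"
  shows "\<exists>cs ds. cs \<noteq> [] \<and> matching i cs ds \<and> x = tail_word i cs ds"
  using assms
proof (induction "length x" arbitrary: i x rule: less_induct)
  case less
  from less.prems obtain u w y
    where uw: "u \<in> R i" "w \<in> R i" "\<pi> i u = \<pi> i w" and x: "x = frame i u y w"
      and y: "y = [Hash2] \<or> yields table_productions [Nt (Back (\<not> i))] y"
    unfolding yields_Back_iff[of i] by (elim bexE conjE exE)
  from y obtain cs ds where "matching (\<not> i) cs ds" "y = tail_word (\<not> i) cs ds"
  proof
    assume "y = [Hash2]"
    then show ?thesis using that[of "[]" "[]"] by (simp add: matching_simps tail_word_simps)
  next
    assume "yields table_productions [Nt (Back (\<not> i))] y"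
    moreover have "length y < length x" unfolding x by (rule length_frame)
    ultimately have "\<exists>cs ds. cs \<noteq> [] \<and> matching (\<not> i) cs ds \<and> y = tail_word (\<not> i) cs ds"
      by (rule less.hyps[rotated])
    then show ?thesis using that by blast
  qed
  then have "matching i (u # cs) (w # ds)" "x = tail_word i (u # cs) (w # ds)"
    using uw x by (simp_all add: matching_simps tail_word_simps)
  then show ?case by (intro exI[of _ "u # cs"] exI[of _ "w # ds"]) simp
qed

lemma yields_BackI:
  assumes "cs \<noteq> []" "matching i cs ds"
  shows "yields table_productions [Nt (Back i)] (tail_word i cs ds)"
  using assms
proof (induction cs arbitrary: i ds)
  case (Cons c cs)
  then obtain d ds' where ds: "ds = d # ds'" by (cases ds) (auto simp: matching_simps)
  with Cons.prems have m: "c \<in> R i" "d \<in> R i" "\<pi> i c = \<pi> i d" "matching (\<not> i) cs ds'"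
    by (simp_all add: matching_simps)
  have "tail_word (\<not> i) cs ds' = [Hash2] \<or>
      yields table_productions [Nt (Back (\<not> i))] (tail_word (\<not> i) cs ds')"
  proof (cases "cs = []")
    case True
    with m(4) show ?thesis by (simp add: matching_simps tail_word_simps)
  next
    case False
    with m(4) Cons.IH show ?thesis by simp
  qed
  with m(1-3) show ?case
    unfolding ds tail_word_simps(2) yields_Back_iff[of i] by blast
qed simp

lemma push_factors_eq_Cons: "bs \<noteq> [] \<Longrightarrow> \<exists>Y zs. push_factors i bs ys = (i, Y) # zs"
  by (cases bs) (simp_all add: push_eq_Cons)

text \<open>The cases describe the end of the outermost block \<open>u\<close>: another block of the
  first factor follows, the second factor starts on the other side, or it starts on the same side
  and its first block is multiplied with \<open>u\<close>.\<close>

lemma yields_FrontD: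
  assumes "yields table_productions [Nt (Front i)] x"
  shows "\<exists>bs j cs ds. bs \<noteq> [] \<and> cs \<noteq> [] \<and> alternating_in R i bs \<and> alternating_in R j cs \<and>
    alternating_in R i ds \<and> push_factors i bs (factors j cs) = factors i ds \<and>
    x = table_word i bs j cs ds"
  using assms
proof (induction "length x" arbitrary: i x rule: less_induct)
  case less
  from less.prems consider
      (longer) u w y where "u \<in> R i" "w \<in> R i" "\<pi> i u = \<pi> i w" "x = frame i u y w"
        "yields table_productions [Nt (Front (\<not> i))] y"
    | (other) u w y where "u \<in> R i" "w \<in> R i" "\<pi> i u = \<pi> i w" "x = frame i u (Hash1 # y) w"
        "yields table_productions [Nt (Back (\<not> i))] y"
    | (same) u v w y where "u \<in> R i" "v \<in> R i" "w \<in> R i" "\<pi> i (u @ v) = \<pi> i w"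
        "x = frame i u (Hash1 # map Letter (block i v) @ y) w"
        "y = [Hash2] \<or> yields table_productions [Nt (Back (\<not> i))] y"
    unfolding yields_Front_iff[of i] by (elim disjE bexE conjE exE) simp_all
  then show ?case
  proof cases
    case longer
    have "length y < length x" unfolding longer(4) by (rule length_frame)
    from less.hyps[OF this longer(5)] obtain bs j cs ds
      where *: "bs \<noteq> []" "cs \<noteq> []" "alternating_in R (\<not> i) bs" "alternating_in R j cs"
        "alternating_in R (\<not> i) ds" "push_factors (\<not> i) bs (factors j cs) = factors (\<not> i) ds"
        "y = table_word (\<not> i) bs j cs ds"
      by (elim exE conjE)
    with longer show ?thesis
      by (intro exI[of _ "u # bs"] exI[of _ j] exI[of _ cs] exI[of _ "w # ds"])
        (simp add: table_word_simps)
  next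
    case other
    from yields_BackD[OF other(5)] obtain cs ds
      where "cs \<noteq> []" "matching (\<not> i) cs ds" "y = tail_word (\<not> i) cs ds" by (elim exE conjE)
    with other show ?thesis
      by (intro exI[of _ "[u]"] exI[of _ "\<not> i"] exI[of _ cs] exI[of _ "w # ds"])
        (simp add: table_word_simps matching_def)
  next
    case same
    from same(6) obtain cs ds where "matching (\<not> i) cs ds" "y = tail_word (\<not> i) cs ds"
    proof
      assume "y = [Hash2]"
      then show ?thesis using that[of "[]" "[]"] by (simp add: matching_simps tail_word_simps)
    next
      assume "yields table_productions [Nt (Back (\<not> i))] y"
      from yields_BackD[OF this] show ?thesis using that by (elim exE conjE)
    qed
    with same show ?thesis
      by (intro exI[of _ "[u]"] exI[of _ i] exI[of _ "v # cs"] exI[of _ "w # ds"])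
        (simp add: table_word_simps matching_def push_def \<pi>_append[symmetric] in_lists_B)
  qed
qed

text \<open>While further blocks of the first factor follow, the head of the product is that of
  \<open>b\<close>, so \<open>b\<close> and \<open>d\<close> have equal values and form a frame. At
  the last block the side \<open>j\<close> decides between a change of side and a product of two
  blocks.\<close>

lemma yields_FrontI:
  assumes "bs \<noteq> []" "cs \<noteq> []" "alternating_in R i bs" "alternating_in R j cs" "alternating_in R i ds"
    "push_factors i bs (factors j cs) = factors i ds"
  shows "yields table_productions [Nt (Front i)] (table_word i bs j cs ds)"
  using assms
proof (induction bs arbitrary: i ds)
  case (Cons b bs)
  have in_R: "b \<in> R i" "alternating_in R (\<not> i) bs" using Cons.prems by simp_all
  have eq: "push i (\<pi> i b) (push_factors (\<not> i) bs (factors j cs)) = factors i ds"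
    using Cons.prems by simp
  then have "ds \<noteq> []"
    using push_eq_Cons[of i "\<pi> i b" "push_factors (\<not> i) bs (factors j cs)"] by auto
  then obtain d ds' where ds: "ds = d # ds'" by (cases ds) auto
  with Cons.prems have d: "d \<in> R i" "alternating_in R (\<not> i) ds'" by simp_all
  consider (longer) "bs \<noteq> []" | (other) "bs = []" "j = (\<not> i)" | (same) "bs = []" "j = i"
    by blast
  then show ?case
  proof cases
    case longer
    then obtain Y zs where "push_factors (\<not> i) bs (factors j cs) = (\<not> i, Y) # zs"
      using push_factors_eq_Cons by blast
    with eq ds have "\<pi> i b = \<pi> i d" "push_factors (\<not> i) bs (factors j cs) = factors (\<not> i) ds'"
      by (simp_all add: push_other)
    with Cons.IH[OF longer Cons.prems(2) in_R(2) Cons.prems(4) d(2)] in_R(1) d(1)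
    show ?thesis
      unfolding yields_Front_iff[of i] ds table_word_simps(1) by blast
  next
    case other
    with eq ds have "\<pi> i b = \<pi> i d" "factors (\<not> i) cs = factors (\<not> i) ds'" by simp_all
    with other Cons.prems(4) d(2)
    have "yields table_productions [Nt (Back (\<not> i))] (tail_word (\<not> i) cs ds')"
      by (intro yields_BackI[OF Cons.prems(2)]) (simp add: matching_def)
    with \<open>\<pi> i b = \<pi> i d\<close> in_R(1) d(1) show ?thesis
      unfolding yields_Front_iff[of i] ds other table_word_simps by blast
  next
    case same
    then obtain c cs' where cs: "cs = c # cs'" using Cons.prems(2) by (cases cs) auto
    with Cons.prems same have c: "c \<in> R i" "alternating_in R (\<not> i) cs'" by simp_all
    from eq ds cs same have "\<pi> i b \<otimes>\<^bsub>S i\<^esub> \<pi> i c = \<pi> i d"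
      and "factors (\<not> i) cs' = factors (\<not> i) ds'" by (simp_all add: push_def)
    then have prod: "\<pi> i (b @ c) = \<pi> i d" and m: "matching (\<not> i) cs' ds'"
      using in_R c d by (simp_all add: \<pi>_append in_lists_B matching_def)
    have "tail_word (\<not> i) cs' ds' = [Hash2] \<or>
        yields table_productions [Nt (Back (\<not> i))] (tail_word (\<not> i) cs' ds')"
      using m yields_BackI[of cs' "\<not> i" ds']
      by (cases "cs' = []") (simp_all add: matching_simps tail_word_simps)
    with prod in_R(1) c(1) d(1) show ?thesis
      unfolding yields_Front_iff[of i] ds cs same table_word_simps by blast
  qed
qed simp

lemma multiplication_table_eq_yields:
  "multiplication_table free_value (alternating_language R) =
     {x. yields table_productions [Nt Start] x}"
proof -
  have Start: "yields table_productions [Nt Start] x \<longleftrightarrow>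
      (\<exists>i. yields table_productions [Nt (Front i)] x)" for x
  proof -
    have "yields table_productions [Nt Start] x \<longleftrightarrow>
        (\<exists>r\<in>table_grammar Start. yields table_productions r x)"
      by (auto simp: yields_singleton_iff[of _ Start] table_productions_def)
    then show ?thesis by (simp add: ex_bool_eq disj_commute)
  qed
  \<comment> \<open>The combing lets \<open>w\<close> start on any side \<open>k\<close>; equality
    of values forces the side of the first factor, as in \<open>table_word\<close>.\<close>
  have head: "k = i" if "bs \<noteq> []" "push_factors i bs ys = factors k ds" for i k bs ds ys
  proof -
    from push_factors_eq_Cons[OF that(1)] obtain Y zs
      where "push_factors i bs ys = (i, Y) # zs" by blast
    with that(2) show ?thesis by (cases ds) auto
  qed
  show ?thesis
  proof (intro equalityI subsetI CollectI)
    fix x assume "x \<in> multiplication_table free_value (alternating_language R)"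
    then obtain i bs j cs k ds where *: "bs \<noteq> []" "alternating_in R i bs" "cs \<noteq> []"
      "alternating_in R j cs" "ds \<noteq> []" "alternating_in R k ds"
      "free_value (alternating_word i bs @ alternating_word j cs) =
         free_value (alternating_word k ds)"
      "x = map Letter (alternating_word i bs) @ [Hash1] @ map Letter (alternating_word j cs) @
         [Hash2] @ map Letter (rev (alternating_word k ds))"
      unfolding multiplication_table_def alternating_language_def by (elim CollectE exE conjE) simp
    then have "push_factors i bs (factors j cs) = factors k ds"
      by (simp add: free_value_mult_iff)
    moreover from head[OF *(1) this] have "k = i" .
    ultimately show "yields table_productions [Nt Start] x"
      unfolding Start *(8) using yields_FrontI[of bs cs i j ds] *
      by (auto simp: table_word_def)
  next
    fix x assume "x \<in> {x. yields table_productions [Nt Start] x}"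
    then obtain i where "yields table_productions [Nt (Front i)] x" using Start by blast
    from yields_FrontD[OF this] obtain bs j cs ds where *: "bs \<noteq> []" "cs \<noteq> []"
      "alternating_in R i bs" "alternating_in R j cs" "alternating_in R i ds"
      "push_factors i bs (factors j cs) = factors i ds" "x = table_word i bs j cs ds"
      by (elim exE conjE)
    from push_factors_eq_Cons[OF *(1), of i "factors j cs"] *(6) have "ds \<noteq> []" by auto
    with * have "free_value (alternating_word i bs @ alternating_word j cs) =
        free_value (alternating_word i ds)"
      by (simp add: free_value_mult_iff)
    with * \<open>ds \<noteq> []\<close> show "x \<in> multiplication_table free_value (alternating_language R)"
      unfolding multiplication_table_def alternating_language_def table_word_def by blast
  qed
qed

theorem word_hyperbolic_free_product:
  "word_hyperbolic_semigroup (Sgp free_letters (\<R> False \<union> \<R> True))"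
proof -
  have "context_free (multiplication_table free_value (alternating_language R))"
    unfolding multiplication_table_eq_yields table_productions_def
    by (rule context_free_extended_grammar) (rule context_free_table_grammar)
  moreover have "alternating_language R \<subseteq> plus_words (free_product_alphabet B)"
    using alternating_language_subset R_subset by blast
  ultimately show ?thesis
    unfolding word_hyperbolic_semigroup_def
    using alg_semigroup_Sgp[OF presentation_free] free_value_epi free_value_image
      regular_alternating_language[of B R] regular_R finite_free_product_alphabet[of B] finite_B
    by blast
qed

end

section \<open>Transport to the presented factors\<close>

text \<open>Composing \<open>\<pi>\<close> with the inverse isomorphism leaves the table literally
  unchanged, because the inverse is injective. The empty word keeps its value, so the identity of
  \<open>M\<close> is carried over to \<open>G\<close> as the image of \<open>[]\<close>.\<close>

lemma combing_of_isomorphic_semigroup: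
  fixes G :: "('s, 'm) monoid_scheme" and M :: "('a, 'c) monoid_scheme"
  assumes "word_hyperbolic_monoid M" "alg_semigroup G" "G \<cong> M"
  shows "\<exists>(B :: nat set) \<pi> R. finite B \<and> (\<forall>w\<in>lists B. \<pi> w \<in> carrier G) \<and>
    (\<forall>u\<in>lists B. \<forall>v\<in>lists B. \<pi> (u @ v) = \<pi> u \<otimes>\<^bsub>G\<^esub> \<pi> v) \<and>
    R \<subseteq> lists B \<and> regular_language B R \<and> \<pi> ` R = carrier G \<and>
    context_free (multiplication_table \<pi> R)"
proof -
  obtain B :: "nat set" and \<pi> R where B: "finite B" "\<pi> \<in> epi (free_monoid B) M"
    "R \<subseteq> lists B" "regular_language B R" "\<pi> ` R = carrier M"
    "context_free (multiplication_table \<pi> R)"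
    using assms(1) unfolding word_hyperbolic_monoid_def by blast
  obtain h where h: "h \<in> hom G M" "bij_betw h (carrier G) (carrier M)"
    using assms(3) by (auto simp: is_iso_def iso_def)
  define g where "g = inv_into (carrier G) h"
  have bij: "bij_betw g (carrier M) (carrier G)"
    unfolding g_def by (rule bij_betw_inv_into[OF h(2)])
  have g_mult: "g (x \<otimes>\<^bsub>M\<^esub> y) = g x \<otimes>\<^bsub>G\<^esub> g y" if "x \<in> carrier M" "y \<in> carrier M" for x y
    unfolding g_def
  proof (rule inv_into_f_eq)
    have *: "inv_into (carrier G) h x \<in> carrier G" "inv_into (carrier G) h y \<in> carrier G"
      using bij that by (auto simp: g_def dest: bij_betwE)
    then show "inv_into (carrier G) h x \<otimes>\<^bsub>G\<^esub> inv_into (carrier G) h y \<in> carrier G"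
      using alg_semigroup.m_closed[OF assms(2)] by blast
    show "h (inv_into (carrier G) h x \<otimes>\<^bsub>G\<^esub> inv_into (carrier G) h y) = x \<otimes>\<^bsub>M\<^esub> y"
      using h * that by (simp add: hom_def bij_betw_inv_into_right)
  qed (use h(2) in \<open>simp add: bij_betw_def\<close>)
  have \<pi>: "\<pi> w \<in> carrier M" "\<pi> (u @ v) = \<pi> u \<otimes>\<^bsub>M\<^esub> \<pi> v"
    if "u \<in> lists B" "v \<in> lists B" "w \<in> lists B" for u v w
    using B(2) that by (auto simp: epi_def hom_def free_monoid_def)
  have "g (\<pi> (u @ v)) = g (\<pi> w) \<longleftrightarrow> \<pi> (u @ v) = \<pi> w" if "u \<in> R" "v \<in> R" "w \<in> R" for u v w
  proof -
    from that have "u @ v \<in> lists B" "w \<in> lists B" using B(3) by auto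
    then have "\<pi> (u @ v) \<in> carrier M" "\<pi> w \<in> carrier M" using \<pi>(1) by blast+
    then show ?thesis using bij by (auto simp: bij_betw_def dest: inj_onD)
  qed
  then have "multiplication_table (\<lambda>w. g (\<pi> w)) R = multiplication_table \<pi> R"
    unfolding multiplication_table_def by blast
  moreover have "(\<lambda>w. g (\<pi> w)) ` R = carrier G"
    using B(5) bij by (simp add: image_image[symmetric] bij_betw_def)
  moreover have "g (\<pi> w) \<in> carrier G" if "w \<in> lists B" for w
    using \<pi>(1)[OF that that that] bij by (auto dest: bij_betwE)
  moreover have "g (\<pi> (u @ v)) = g (\<pi> u) \<otimes>\<^bsub>G\<^esub> g (\<pi> v)" if "u \<in> lists B" "v \<in> lists B" for u v
    using that \<pi> g_mult by simp
  ultimately show ?thesis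
    using B by (intro exI[of _ B] exI[of _ "\<lambda>w. g (\<pi> w)"] exI[of _ R]) simp
qed

theorem corollary2p5:
  fixes M\<^sub>1 :: "('a, 'c) monoid_scheme" and M\<^sub>2 :: "('b, 'd) monoid_scheme"
    and A\<^sub>1 A\<^sub>2 :: "'x set" and \<R>\<^sub>1 \<R>\<^sub>2 :: "('x list \<times> 'x list) set"
  assumes "word_hyperbolic_monoid M\<^sub>1" and "word_hyperbolic_monoid M\<^sub>2"
    and "presentation A\<^sub>1 \<R>\<^sub>1" and "Sgp A\<^sub>1 \<R>\<^sub>1 \<cong> M\<^sub>1"
    and "presentation A\<^sub>2 \<R>\<^sub>2" and "Sgp A\<^sub>2 \<R>\<^sub>2 \<cong> M\<^sub>2"
    and "A\<^sub>1 \<inter> A\<^sub>2 = {}"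
  shows "word_hyperbolic_semigroup (semigroup_free_product A\<^sub>1 \<R>\<^sub>1 A\<^sub>2 \<R>\<^sub>2)"
proof -
  obtain B1 :: "nat set" and \<pi>1 R1 where 1: "finite B1"
    "\<forall>w\<in>lists B1. \<pi>1 w \<in> carrier (Sgp A\<^sub>1 \<R>\<^sub>1)"
    "\<forall>u\<in>lists B1. \<forall>v\<in>lists B1. \<pi>1 (u @ v) = \<pi>1 u \<otimes>\<^bsub>Sgp A\<^sub>1 \<R>\<^sub>1\<^esub> \<pi>1 v"
    "R1 \<subseteq> lists B1" "regular_language B1 R1" "\<pi>1 ` R1 = carrier (Sgp A\<^sub>1 \<R>\<^sub>1)"
    "context_free (multiplication_table \<pi>1 R1)"
    using combing_of_isomorphic_semigroup[OF assms(1) alg_semigroup_Sgp[OF assms(3)] assms(4)]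
    by (elim exE conjE)
  obtain B2 :: "nat set" and \<pi>2 R2 where 2: "finite B2"
    "\<forall>w\<in>lists B2. \<pi>2 w \<in> carrier (Sgp A\<^sub>2 \<R>\<^sub>2)"
    "\<forall>u\<in>lists B2. \<forall>v\<in>lists B2. \<pi>2 (u @ v) = \<pi>2 u \<otimes>\<^bsub>Sgp A\<^sub>2 \<R>\<^sub>2\<^esub> \<pi>2 v"
    "R2 \<subseteq> lists B2" "regular_language B2 R2" "\<pi>2 ` R2 = carrier (Sgp A\<^sub>2 \<R>\<^sub>2)"
    "context_free (multiplication_table \<pi>2 R2)"
    using combing_of_isomorphic_semigroup[OF assms(2) alg_semigroup_Sgp[OF assms(5)] assms(6)]
    by (elim exE conjE)
  interpret free_product_combing "\<lambda>i. if i then A\<^sub>2 else A\<^sub>1" "\<lambda>i. if i then \<R>\<^sub>2 else \<R>\<^sub>1"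
    "\<lambda>i. if i then B2 else B1" "\<lambda>i. if i then \<pi>2 else \<pi>1" "\<lambda>i. if i then R2 else R1"
    by unfold_locales (use assms 1 2 in \<open>simp_all split: if_splits\<close>)
  show ?thesis
    using word_hyperbolic_free_product by (simp add: semigroup_free_product_def)
qed

end
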